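(* Let $n,k\in \mathbb{N}$ (positive integers). For any $b\in \mathbb{R}\setminus \mathbb{Z}$, there exists a function $\Pi^n_k:\mathbb{R}^n\to \mathbb{R}_+$ such that $\Pi^n_k$ has at least $k$ slopes, is genuinely $n$ dimensional, and is a facet (and thus extreme) for the $n$-dimensional infinite group relaxation $I_{b\mathbf{1}_n}$.
   Context: $\mathbf{1}_n\in\mathbb{R}^n$ is the vector of all ones, so $b\mathbf{1}_n$ is the vector with every component equal to $b$. Let $\mathbb{R}_+$ and $\mathbb{Z}_+$ denote the nonnegative reals and integers. For $\beta\in\mathbb{R}^n\setminus\mathbb{Z}^n$, the infinite group relaxation $I_\beta$ is the set of functions $y:\mathbb{R}^n\to\mathbb{Z}_+$ with finite support satisfying $\sum_{r\in\mathbb{R}^n} r\,y(r)\in \beta+\mathbb{Z}^n$. A function $\pi:\mathbb{R}^n\to\mathbb{R}_+$ is valid for $I_\beta$ if $\sum_{r\in\mathbb{R}^n}\pi(r)y(r)\ge 1$ for every $y\in I_\beta$. A valid function $\pi$ is extreme if $\pi=\pi_1=\pi_2$ for every pair of valid functions $\pi_1,\pi_2$ with $\pi=\frac{\pi_1+\pi_2}{2}$. For a valid function $\pi$ let $P(\pi):=\{y\in I_\beta: \sum_{r\in\mathbb{R}^n}\pi(r)y(r)=1\}$. A valid function $\pi$ is a facet if for every valid function $\pi'$, $P(\pi)\subseteq P(\pi')$ implies $\pi=\pi'$. A function $\theta:\mathbb{R}^n\to\mathbb{R}$ is genuinely $n$-dimensional if there do not exist a linear map $T:\mathbb{R}^n\to\mathbb{R}^{n-1}$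 and a function $\theta':\mathbb{R}^{n-1}\to\mathbb{R}$ such that $\theta=\theta'\circ T$. A regular polyhedral complex in $\mathbb{R}^n$ is a collection of polyhedra $P_j$, $j\in J$, such that (1) $\mathbb{R}^n=\bigcup_{j\in J}P_j$, (2) for any $i,j\in J$, $P_i\cap P_j$ is a common face of $P_i$ and $P_j$ and also belongs to the collection, (3) any bounded subset of $\mathbb{R}^n$ intersects only finitely many polyhedra of the collection. A function $\theta:\mathbb{R}^n\to\mathbb{R}$ is piecewise linear if there is a regular polyhedral complex in $\mathbb{R}^n$ such that $\theta$ is affine over the interior of each polyhedron of the complex. The notion of slopes is for piecewise linear functions: a piecewise linear function has at least $k$ slopes if its gradient, where it exists, takes at least $k$ distinct values. *)

theory Defs
  imports "HOL-Analysis.Analysis"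
begin

definition integer_lattice :: "(real ^ 'n) set" where
  "integer_lattice = {z. \<forall>i. z $ i \<in> \<int>}"

definition group_relaxation :: "real ^ 'n \<Rightarrow> (real ^ 'n \<Rightarrow> nat) set" where
  "group_relaxation \<beta> =
     {y. finite {r. y r \<noteq> 0} \<and>
         (\<exists>z\<in>integer_lattice. (\<Sum>r | y r \<noteq> 0. real (y r) *\<^sub>R r) = \<beta> + z)}"

definition cut_value :: "(real ^ 'n \<Rightarrow> real) \<Rightarrow> (real ^ 'n \<Rightarrow> nat) \<Rightarrow> real" where
  "cut_value \<pi> y = (\<Sum>r | y r \<noteq> 0. \<pi> r * real (y r))"

definition valid_function :: "real ^ 'n \<Rightarrow> (real ^ 'n \<Rightarrow> real) \<Rightarrow> bool" where
  "valid_function \<beta> \<pi> \<longleftrightarrow>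
     (\<forall>r. 0 \<le> \<pi> r) \<and> (\<forall>y\<in>group_relaxation \<beta>. 1 \<le> cut_value \<pi> y)"

definition extreme_function :: "real ^ 'n \<Rightarrow> (real ^ 'n \<Rightarrow> real) \<Rightarrow> bool" where
  "extreme_function \<beta> \<pi> \<longleftrightarrow>
     valid_function \<beta> \<pi> \<and>
     (\<forall>\<pi>1 \<pi>2. valid_function \<beta> \<pi>1 \<longrightarrow> valid_function \<beta> \<pi>2 \<longrightarrow>
        \<pi> = (\<lambda>r. (\<pi>1 r + \<pi>2 r) / 2) \<longrightarrow> \<pi> = \<pi>1 \<and> \<pi>1 = \<pi>2)"

definition tight_set :: "real ^ 'n \<Rightarrow> (real ^ 'n \<Rightarrow> real) \<Rightarrow> (real ^ 'n \<Rightarrow> nat) set" where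
  "tight_set \<beta> \<pi> = {y \<in> group_relaxation \<beta>. cut_value \<pi> y = 1}"

definition facet_function :: "real ^ 'n \<Rightarrow> (real ^ 'n \<Rightarrow> real) \<Rightarrow> bool" where
  "facet_function \<beta> \<pi> \<longleftrightarrow>
     valid_function \<beta> \<pi> \<and>
     (\<forall>\<pi>'. valid_function \<beta> \<pi>' \<longrightarrow> tight_set \<beta> \<pi> \<subseteq> tight_set \<beta> \<pi>' \<longrightarrow> \<pi> = \<pi>')"

text \<open>
  The space of dimension one less than that of the domain need not be the value of a type
  expression (it is a single point if the domain is a line), so it is taken to be
  \<^term>\<open>topspace (Euclidean_space (CARD('n::finite) - 1))\<close>, the real sequences that vanish from
  index \<^term>\<open>CARD('n::finite) - 1\<close> on. A map into it is linear iff all its coordinates are.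
  Only the values of \<open>\<theta>'\<close> on that space matter.
\<close>

definition genuinely_full_dimensional :: "(real ^ 'n \<Rightarrow> real) \<Rightarrow> bool" where
  "genuinely_full_dimensional \<theta> \<longleftrightarrow>
     \<not> (\<exists>(T :: real ^ 'n \<Rightarrow> nat \<Rightarrow> real) (\<theta>' :: (nat \<Rightarrow> real) \<Rightarrow> real).
          (\<forall>x. T x \<in> topspace (Euclidean_space (CARD('n) - 1))) \<and>
          (\<forall>i. linear (\<lambda>x. T x i)) \<and>
          \<theta> = \<theta>' \<circ> T)"

definition regular_polyhedral_complex :: "(real ^ 'n) set set \<Rightarrow> bool" where
  "regular_polyhedral_complex \<P> \<longleftrightarrow>
     (\<forall>P\<in>\<P>. polyhedron P) \<and>
     \<Union>\<P> = UNIV \<and>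
     (\<forall>P\<in>\<P>. \<forall>Q\<in>\<P>. (P \<inter> Q) face_of P \<and> (P \<inter> Q) face_of Q \<and> P \<inter> Q \<in> \<P>) \<and>
     (\<forall>B. bounded B \<longrightarrow> finite {P \<in> \<P>. P \<inter> B \<noteq> {}})"

definition piecewise_linear :: "(real ^ 'n \<Rightarrow> real) \<Rightarrow> bool" where
  "piecewise_linear \<theta> \<longleftrightarrow>
     (\<exists>\<P>. regular_polyhedral_complex \<P> \<and>
        (\<forall>P\<in>\<P>. \<exists>a c. \<forall>x\<in>interior P. \<theta> x = a \<bullet> x + c))"

definition slopes :: "(real ^ 'n \<Rightarrow> real) \<Rightarrow> (real ^ 'n) set" where
  "slopes \<theta> = {g. \<exists>x. GDERIV \<theta> x :> g}"

text \<open>The set of slopes may be infinite, hence no direct use of \<^const>\<open>card\<close>.\<close>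

definition has_at_least_slopes :: "nat \<Rightarrow> (real ^ 'n \<Rightarrow> real) \<Rightarrow> bool" where
  "has_at_least_slopes k \<theta> \<longleftrightarrow>
     piecewise_linear \<theta> \<and> (\<exists>S \<subseteq> slopes \<theta>. finite S \<and> card S = k)"

end

theory Submission
  imports Defs
begin

text \<open>
  By periodicity and the symmetry \<open>x \<mapsto> - x\<close> we may take \<open>1 / 2 \<le> b < 1\<close>. Consider first a
  \<open>1\<close>-periodic \<open>F\<close> on the line that has slope one except on \<open>k\<close> short teeth to the right of \<open>0\<close>
  (and, by symmetry, to the left of \<open>b\<close>). Its downward jumps leave room for the teeth: each tooth
  lies on a line through the origin, whose slope is determined because at its tip \<open>r\<close> the
  inequality \<open>F r \<le> F y + F (r - y)\<close> with \<open>r - y < 0 < y\<close> is tight.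

  In higher dimension, let \<open>x\<close> have value \<open>F (x $ i) / b\<close> unless \<open>x\<close> lies in the subgroup
  \<open>x $ i \<in> \<int>\<close> or in its translate by \<open>vec b\<close>. Since \<open>F\<close> jumps by \<open>1 / 3\<close> at the integers, on the
  subgroup there is room for \<open>1 / (3 * b)\<close> times a function of the same kind of the other
  coordinates. This changes nothing in the interiors of full-dimensional cells, so the resulting
  function is piecewise linear, but it vanishes only on the integer lattice and hence is
  genuinely full-dimensional.
\<close>

section \<open>A one-dimensional profile\<close>

text \<open>Tooth \<open>j\<close> is a line through the origin that reaches \<open>1 / 3\<close> at
  its tip \<open>w / 8 ^ j\<close>. Shorter teeth override longer ones, and the shortest runs down
  to \<open>0\<close>. The ratio \<open>8\<close> makes each tooth long enough for
  \<open>slab_additive_linear\<close>.\<close>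

fun sawtooth :: "real \<Rightarrow> nat \<Rightarrow> real \<Rightarrow> real" where
  "sawtooth w 0 x = 0"
| "sawtooth w (Suc j) x = (if 0 < x \<and> x \<le> w / 8 ^ j then x * 8 ^ j / (3 * w) else sawtooth w j x)"

lemma sawtooth_bounds:
  assumes "0 < w"
  shows "0 \<le> sawtooth w j x \<and> sawtooth w j x \<le> 1 / 3"
  using assms by (induction j) (auto simp: field_simps)

lemma sawtooth_outside:
  assumes "0 < w" "x \<le> 0 \<or> w < x"
  shows "sawtooth w j x = 0"
proof (induction j)
  case (Suc j)
  have "w / 8 ^ j \<le> w" using assms(1) by (simp add: field_simps)
  then show ?case using Suc assms by auto
qed simp

text \<open>Slopes drop from each tooth to the next longer one, and beyond the tip of a tooth the
  bound \<open>1 / 3\<close> lies below its line. Monotonicity of this quotient yields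
  subadditivity.\<close>

lemma sawtooth_ratio:
  assumes w: "0 < w" and "0 < x" "x \<le> y"
  shows "sawtooth w j y * x \<le> sawtooth w j x * y"
proof (induction j)
  case (Suc j)
  consider "y \<le> w / 8 ^ j" | "w / 8 ^ j < x" | "x \<le> w / 8 ^ j" "w / 8 ^ j < y" by linarith
  then show ?case
  proof cases
    case 3
    have "sawtooth w j y * (3 * w) \<le> w"
      using sawtooth_bounds[OF w, of j y] w by (simp add: field_simps)
    also have "w \<le> y * 8 ^ j" using 3 by (simp add: field_simps)
    finally have "sawtooth w j y * (3 * w) * x \<le> y * 8 ^ j * x"
      using assms by (intro mult_right_mono) auto
    then show ?thesis using 3 assms by (simp add: field_simps)
  next
    case 1
    moreover have "x \<le> w / 8 ^ j" using 1 assms by linarith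
    ultimately show ?thesis using assms by (simp add: mult_ac)
  next
    case 2
    moreover have "w / 8 ^ j < y" using 2 assms by linarith
    ultimately show ?thesis using Suc by simp
  qed
qed simp

lemma sawtooth_subadditive:
  assumes w: "0 < w" and "0 \<le> x" "0 \<le> y"
  shows "sawtooth w j (x + y) \<le> sawtooth w j x + sawtooth w j y"
proof (cases "x = 0 \<or> y = 0")
  case True
  then show ?thesis using sawtooth_bounds[OF w] by auto
next
  case False
  then have pos: "0 < x" "0 < y" using assms by auto
  have "sawtooth w j (x + y) * (x + y) \<le> (sawtooth w j x + sawtooth w j y) * (x + y)"
    using sawtooth_ratio[OF w pos(1), of "x + y" j] sawtooth_ratio[OF w pos(2), of "x + y" j] pos
    by (simp add: algebra_simps)
  then show ?thesis using pos by simp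
qed

lemma sawtooth_tooth:
  assumes w: "0 < w" and "j < k" "w / 8 ^ Suc j < x" "x \<le> w / 8 ^ j"
  shows "sawtooth w k x = x * 8 ^ j / (3 * w)"
  using assms(2)
proof (induction k)
  case (Suc k)
  have x: "0 < x" using assms by (smt (verit) divide_pos_pos zero_less_power)
  show ?case
  proof (cases "j = k")
    case True
    then show ?thesis using assms x by simp
  next
    case False
    then have "j < k" using Suc by simp
    then have "(8::real) ^ Suc j \<le> 8 ^ k" by (intro power_increasing) auto
    then have "w / 8 ^ k \<le> w / 8 ^ Suc j" using w by (intro divide_left_mono) auto
    then show ?thesis using Suc \<open>j < k\<close> assms by auto
  qed
qed simp

text \<open>Prepares a tooth for \<open>slab_additive_linear\<close>, which asks for
  \<open>4 * l < r\<close>. The conjunct \<open>w / 8 ^ j \<le> r\<close> is for the induction: a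
  new tip \<open>q\<close> with \<open>8 * q = w / 8 ^ j\<close> may cut off the lower end of an
  older piece, and \<open>4 * q < r\<close> still holds.\<close>

lemma sawtooth_piece:
  assumes w: "0 < w" and "0 < t" "t \<le> w"
  shows "\<exists>l r. 0 \<le> l \<and> 4 * l < r \<and> w / 8 ^ j \<le> r \<and> r \<le> w \<and> l < t \<and> t \<le> r \<and>
    (\<forall>s. l < s \<and> s \<le> r \<longrightarrow> sawtooth w (Suc j) s = s / (3 * r))"
proof (induction j)
  case 0
  show ?case by (rule exI[of _ 0], rule exI[of _ w]) (use assms in auto)
next
  case (Suc j)
  define q where "q = w / 8 ^ Suc j"
  have q: "0 < q" "q \<le> w" "8 * q = w / 8 ^ j"
    using w one_le_power[of "8::real" "Suc j"] by (auto simp: q_def field_simps)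
  show ?case
  proof (cases "t \<le> q")
    case True
    show ?thesis
      by (rule exI[of _ 0], rule exI[of _ q])
        (use True q assms in \<open>auto simp: q_def simp del: power_Suc\<close>)
  next
    case False
    obtain l r where lr: "0 \<le> l" "4 * l < r" "w / 8 ^ j \<le> r" "r \<le> w" "l < t" "t \<le> r"
      "\<forall>s. l < s \<and> s \<le> r \<longrightarrow> sawtooth w (Suc j) s = s / (3 * r)"
      using Suc by blast
    have "sawtooth w (Suc (Suc j)) s = s / (3 * r)" if "max l q < s \<and> s \<le> r" for s
      using that lr(7) q_def sawtooth.simps(2)[of w "Suc j" s] by auto
    then show ?thesis
      by (intro exI[of _ "max l q"] exI[of _ r]) (use False q lr in \<open>auto simp flip: q_def\<close>)
  qed
qed

section \<open>The profile \<open>F\<close>: symmetry, positivity and the triple inequality\<close>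

locale profile =
  fixes b :: real and k :: nat
  assumes half_le: "1 / 2 \<le> b" and less_one: "b < 1" and k_pos: "0 < k"
begin

text \<open>The interval from \<open>b\<close> to \<open>1\<close> has length \<open>16 * w\<close>;
  \<open>step\<close> splits it into lengths \<open>6 * w\<close>, \<open>4 * w\<close>,
  \<open>6 * w\<close>. The teeth occupy length \<open>w\<close> next to \<open>0\<close> and
  \<open>b\<close>.\<close>

definition w :: real where "w = (1 - b) / 16"

lemma w_pos: "0 < w" and w_eq: "b = 1 - 16 * w" and w_le: "32 * w \<le> 1"
  using half_le less_one by (auto simp: w_def field_simps)

text \<open>The values satisfy \<open>step t + step (1 + b - t) = 1\<close> for
  \<open>b < t < 1\<close>, the source of the symmetry \<open>F_sym\<close>. For this the plateau
  contains both of its end points.\<close>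

definition step :: "real \<Rightarrow> real" where
  "step t = (if t \<le> b then 0 else if t < b + 6 * w then 1 / 3 else if t \<le> 1 - 6 * w then 1 / 2 else 2 / 3)"

definition base :: "real \<Rightarrow> real" where
  "base t = t - step t + sawtooth w k t - sawtooth w k (b - t)"

definition F :: "real \<Rightarrow> real" where
  "F t = base (frac t)"

lemmas saw_bounds = sawtooth_bounds[OF w_pos, of k]
lemmas saw_outside = sawtooth_outside[OF w_pos, of _ k]

lemma b_notin_Ints: "b \<notin> \<int>"
  using half_le less_one by (auto elim!: Ints_cases)

lemma F_add_Ints: "n \<in> \<int> \<Longrightarrow> F (t + n) = F t"
  by (auto simp: F_def frac_def elim!: Ints_cases)

lemma F_unit: "0 \<le> t \<Longrightarrow> t < 1 \<Longrightarrow> F t = base t"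
  by (simp add: F_def frac_eq)

lemma F_mid: "w < t \<Longrightarrow> t < b - w \<Longrightarrow> F t = t"
  using w_pos less_one by (simp add: F_unit base_def step_def saw_outside)

lemma F_small: "0 < t \<Longrightarrow> t \<le> w \<Longrightarrow> F t = t + sawtooth w k t"
  using w_pos w_le w_eq by (simp add: F_unit base_def step_def saw_outside)

lemma F_plateau: "b + 6 * w \<le> t \<Longrightarrow> t \<le> 1 - 6 * w \<Longrightarrow> F t = t - 1 / 2"
  using w_pos w_le w_eq by (simp add: F_unit base_def step_def saw_outside)

lemma F_neg:
  assumes "- 6 * w < t" "t < 0"
  shows "F t = t + 1 / 3"
proof -
  have "F t = F (t + 1)" by (simp add: F_add_Ints)
  also have "\<dots> = t + 1 / 3"
    using assms w_pos w_le w_eq by (simp add: F_unit base_def step_def saw_outside)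
  finally show ?thesis .
qed

lemma base_sym:
  assumes "0 \<le> t" "t < 1"
  shows "base t + F (b - t) = b"
proof (cases "t \<le> b")
  case True
  then show ?thesis using assms half_le less_one by (simp add: F_unit base_def step_def)
next
  case False
  have "F (b - t) = F (b - t + 1)" by (simp add: F_add_Ints)
  also have "\<dots> = base (b - t + 1)" using False assms half_le by (intro F_unit) auto
  finally show ?thesis using False assms w_pos w_eq w_le
    by (auto simp: base_def step_def saw_outside)
qed

lemma F_sym: "F t + F (b - t) = b"
proof -
  have "F (b - frac t) = F (b - t)"
    using F_add_Ints[of "of_int \<lfloor>t\<rfloor>" "b - t"] by (simp add: frac_def algebra_simps)
  then show ?thesis using base_sym[of "frac t"] by (simp add: F_def frac_lt_1)
qed

lemma base_pos:
  assumes "0 < t" "t < 1"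
  shows "0 < base t"
proof (cases "t < b - w")
  case True
  then show ?thesis
    using assms saw_bounds[of t] saw_outside[of "b - t"] w_pos by (simp add: base_def step_def)
next
  case False
  have "t \<le> b \<or> sawtooth w k (b - t) = 0" using saw_outside[of "b - t"] by force
  then show ?thesis
    using False saw_bounds[of t] saw_bounds[of "b - t"] w_pos w_le w_eq
    by (auto simp: base_def step_def)
qed

lemma F_pos: "t \<notin> \<int> \<Longrightarrow> 0 < F t"
  using base_pos[of "frac t"] frac_lt_1[of t] frac_ge_0[of t] frac_eq_0_iff[of t]
  by (auto simp: F_def less_le)

text \<open>
  What is subtracted from \<open>t\<close> in \<^term>\<open>base t\<close>. The jumps are multiples of \<open>1 / 3\<close> because three
  arguments in \<open>{1 - 6 * w<..<1}\<close> can have sum \<open>b + 2\<close>; the plateau of height \<open>1 / 2\<close> prevents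
  a jump at \<open>(1 + b) / 2\<close>, a fixed point of \<open>t \<mapsto> b - t\<close> modulo \<open>1\<close>.
\<close>

definition loss :: "real \<Rightarrow> real" where
  "loss t = step t + sawtooth w k (b - t)"

lemma loss_cases:
  obtains "t < b - w" "loss t = 0" | "b - w \<le> t" "t < b + 6 * w" "loss t \<le> 1 / 3"
  | "b + 6 * w \<le> t" "t \<le> 1 - 6 * w" "loss t = 1 / 2" | "1 - 6 * w < t" "loss t = 2 / 3"
  using saw_bounds[of "b - t"] saw_outside[of "b - t"] w_pos w_le w_eq
  by (fastforce simp: loss_def step_def split: if_splits)

lemma loss_le: "loss t \<le> 2 / 3"
  by (rule loss_cases[of t]) auto

text \<open>Large losses need large arguments. An argument above \<open>1 - 6 * w\<close> leaves no
  room for one on the plateau or a second one above \<open>1 - 6 * w\<close>, and at most one other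
  argument reaches \<open>b - w\<close>. If all three reach \<open>b - w\<close>, all lie below the
  plateau and lose at most \<open>1 / 3\<close> each.\<close>

lemma loss_sum_le_one:
  assumes "0 \<le> x" "0 \<le> y" "0 \<le> z" "x + y + z = b + 1"
  shows "loss x + loss y + loss z \<le> 1"
  using assms w_pos w_le w_eq
  by (cases rule: loss_cases[of x]; cases rule: loss_cases[of y]; cases rule: loss_cases[of z])
    linarith+

text \<open>Only \<open>x\<close> can have a loss, namely the mirrored tooth
  \<open>sawtooth w k (b - x)\<close> with \<open>b - x = y + z\<close>; the sawtooth is
  subadditive.\<close>

lemma loss_sum_le_sawtooth:
  assumes "0 \<le> x" "0 \<le> y" "0 \<le> z" "x + y + z = b" "b - w \<le> x"
  shows "loss x + loss y + loss z \<le> sawtooth w k x + sawtooth w k y + sawtooth w k z"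
proof -
  have "loss y = 0" "loss z = 0"
    using assms w_pos w_le w_eq by (auto simp: loss_def step_def saw_outside)
  moreover have "loss x = sawtooth w k (y + z)"
    using assms by (auto simp: loss_def step_def algebra_simps)
  ultimately show ?thesis
    using sawtooth_subadditive[OF w_pos assms(2,3), of k] saw_bounds[of x] by linarith
qed

text \<open>Expanding \<open>base\<close> reduces this to a total loss of at most \<open>n\<close>
  plus the total sawtooth. The ranges of the variables leave \<open>n = 0, 1, 2\<close>, and for
  \<open>n = 2\<close> the bound \<open>2 / 3\<close> on each loss suffices.\<close>

lemma base_triple:
  assumes nonneg: "0 \<le> x" "0 \<le> y" "0 \<le> z" and "x < 1" "y < 1" "z < 1"
    and sum: "x + y + z = b + of_int n"
  shows "b \<le> base x + base y + base z"
proof -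
  have "- 1 < real_of_int n" "real_of_int n < 3" using assms half_le less_one by linarith+
  then have "n = 0 \<or> n = 1 \<or> n = 2" by linarith
  moreover have "loss x + loss y + loss z \<le> sawtooth w k x + sawtooth w k y + sawtooth w k z"
    if "n = 0"
  proof -
    consider "b - w \<le> x" | "b - w \<le> y" | "b - w \<le> z" | "x < b - w" "y < b - w" "z < b - w"
      by linarith
    then show ?thesis
    proof cases
      case 4
      then have "loss x = 0" "loss y = 0" "loss z = 0"
        using w_pos by (auto simp: loss_def step_def saw_outside)
      then show ?thesis using saw_bounds[of x] saw_bounds[of y] saw_bounds[of z] by linarith
    qed (use that sum loss_sum_le_sawtooth[of x y z] loss_sum_le_sawtooth[of y x z] loss_sum_le_sawtooth[of z x y] nonneg
        in \<open>auto simp: algebra_simps\<close>)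
  qed
  moreover have "loss x + loss y + loss z \<le> 1" if "n = 1"
    using loss_sum_le_one[OF nonneg] sum that by simp
  ultimately show ?thesis
    using sum saw_bounds[of x] saw_bounds[of y] saw_bounds[of z]
      loss_le[of x] loss_le[of y] loss_le[of z]
    by (auto simp: base_def loss_def)
qed

lemma F_triple:
  assumes "x + y + z = b"
  shows "b \<le> F x + F y + F z"
proof -
  have "frac x + frac y + frac z = b + of_int (- \<lfloor>x\<rfloor> - \<lfloor>y\<rfloor> - \<lfloor>z\<rfloor>)"
    using assms by (simp add: frac_def)
  then show ?thesis
    unfolding F_def by (rule base_triple[rotated -1]) (simp_all add: frac_lt_1)
qed

text \<open>The losses at \<open>t\<close> and \<open>1 - t\<close> add up to at most
  \<open>2 / 3\<close>. The remaining \<open>1 / 3\<close> is the room for the values on the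
  subgroup \<open>x $ i \<in> \<int>\<close> and its translate.\<close>

lemma base_opposite:
  assumes "0 < t" "t \<le> 1 / 2"
  shows "1 / 3 \<le> base t + base (1 - t)"
proof -
  have "loss t + loss (1 - t) \<le> 2 / 3"
    using assms w_pos w_le w_eq
    by (cases rule: loss_cases[of t]; cases rule: loss_cases[of "1 - t"]) linarith+
  then show ?thesis using saw_bounds[of t] saw_bounds[of "1 - t"] by (simp add: base_def loss_def)
qed

lemma F_opposite:
  assumes "t \<notin> \<int>"
  shows "1 / 3 \<le> F t + F (- t)"
proof -
  have "0 < frac t" using assms by (simp add: frac_gt_0_iff)
  moreover have "frac (- t) = 1 - frac t" using assms by (simp add: frac_neg)
  ultimately show ?thesis
    using base_opposite[of "frac t"] base_opposite[of "1 - frac t"] frac_lt_1[of t]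
    by (cases "frac t \<le> 1 / 2") (auto simp: F_def)
qed

lemma F_minus_b: "2 / 3 \<le> F (- b) + b"
proof -
  have "F (- b) = F (1 - b)" using F_add_Ints[of 1 "- b"] by simp
  also have "\<dots> = base (1 - b)" using half_le less_one by (simp add: F_unit)
  also have "2 / 3 - b \<le> \<dots>"
    using half_le saw_bounds[of "1 - b"] saw_bounds[of "b - (1 - b)"]
    by (simp add: base_def step_def)
  finally show ?thesis by simp
qed

end

section \<open>Adding one coordinate\<close>

text \<open>
  Subtracting the linear function that agrees with \<open>g\<close> at \<open>x0\<close> leaves a bounded additive
  \<open>d\<close> with \<open>d x0 = 0\<close>. Reducing multiples of \<open>x\<close> modulo \<open>x0\<close> keeps them in the
  slab, so all multiples of \<open>d x\<close> are values of \<open>d\<close>.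
\<close>

lemma slab_additive_linear:
  fixes g :: "real ^ 'n \<Rightarrow> real"
  assumes l: "0 \<le> l" "4 * l < r"
    and add: "\<And>x y. l < x $ i \<Longrightarrow> l < y $ i \<Longrightarrow> x $ i + y $ i \<le> r \<Longrightarrow> g (x + y) = g x + g y"
    and bound: "\<And>x. \<bar>g x\<bar> \<le> K"
  shows "\<exists>s. \<forall>x. l < x $ i \<and> x $ i \<le> r \<longrightarrow> g x = s * x $ i"
proof -
  define x0 :: "real ^ 'n" where "x0 = axis i (r / 4)"
  have x0: "x0 $ i = r / 4" by (simp add: x0_def)
  define s where "s = g x0 / (r / 4)"
  define d where "d x = g x - s * x $ i" for x
  have d_x0: "d x0 = 0" using l by (simp add: d_def s_def x0)
  have d_add: "d (x + y) = d x + d y" if "l < x $ i" "l < y $ i" "x $ i + y $ i \<le> r" for x y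
    using add[OF that] by (simp add: d_def algebra_simps)
  have lower: "d x = 0" if x: "l < x $ i" "x $ i \<le> r / 2" for x
  proof -
    have "\<exists>y. l < y $ i \<and> y $ i \<le> l + r / 4 \<and> d y = real n * d x" for n
    proof (induction n)
      case 0
      show ?case using x0 d_x0 l by (intro exI[of _ x0]) auto
    next
      case (Suc n)
      then obtain y where y: "l < y $ i" "y $ i \<le> l + r / 4" "d y = real n * d x" by blast
      have yx: "d (y + x) = real (Suc n) * d x"
        using d_add[of y x] x y l by (simp add: algebra_simps)
      \<comment> \<open>As \<open>y $ i + x $ i \<le> l + 3 * r / 4\<close>, at most two
        subtractions of \<open>x0\<close> lead back to the window of width \<open>r / 4\<close>
        above \<open>l\<close>.\<close>
      have "\<exists>m. l < (y + x - real m *\<^sub>R x0) $ i \<and> (y + x - real m *\<^sub>R x0) $ i \<le> l + r / 4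
        \<and> d (y + x - real m *\<^sub>R x0) = real (Suc n) * d x"
      proof -
        have step: "d (v - x0) = d v" if "l + r / 4 < v $ i" "v $ i \<le> r" for v
          using d_add[of "v - x0" x0] that l by (simp add: x0 d_x0)
        have vi: "(y + x) $ i \<le> l + r / 4 + r / 2" "l < (y + x) $ i" using x y l by auto
        have *: "y + x - real (Suc m) *\<^sub>R x0 = (y + x - real m *\<^sub>R x0) - x0" for m
          by (simp add: algebra_simps)
        consider "(y + x) $ i \<le> l + r / 4" | "l + r / 4 < (y + x) $ i" "(y + x) $ i \<le> l + r / 2"
          | "l + r / 2 < (y + x) $ i" by linarith
        then show ?thesis
        proof cases
          case 1
          then show ?thesis using vi yx by (intro exI[of _ 0]) auto
        next
          case 2
          then show ?thesis using vi yx l step[of "y + x"] by (intro exI[of _ 1]) (auto simp: x0)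
        next
          case 3
          have "d (y + x - x0) = d (y + x)" using 3 vi l by (intro step) auto
          moreover have "d (y + x - x0 - x0) = d (y + x - x0)"
            using 3 vi l by (intro step) (auto simp: x0)
          moreover have "y + x - real 2 *\<^sub>R x0 = y + x - x0 - x0" by (simp add: scaleR_2)
          ultimately show ?thesis using 3 vi yx l
            by (intro exI[of _ 2]) (auto simp: x0)
        qed
      qed
      then show ?case by blast
    qed
    then obtain Y where Y: "\<And>n. l < Y n $ i \<and> Y n $ i \<le> l + r / 4 \<and> d (Y n) = real n * d x"
      by metis
    have "real n * \<bar>d x\<bar> \<le> K + \<bar>s\<bar> * r" for n
    proof -
      have "\<bar>d (Y n)\<bar> \<le> \<bar>g (Y n)\<bar> + \<bar>s * Y n $ i\<bar>" by (simp add: d_def)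
      also have "\<bar>s * Y n $ i\<bar> \<le> \<bar>s\<bar> * r"
        unfolding abs_mult using Y[of n] l by (intro mult_left_mono) auto
      finally have "\<bar>d (Y n)\<bar> \<le> K + \<bar>s\<bar> * r" using bound[of "Y n"] by linarith
      then show ?thesis using Y[of n] by (simp add: abs_mult)
    qed
    moreover have "\<exists>n. K + \<bar>s\<bar> * r < real n * \<bar>d x\<bar>" if "d x \<noteq> 0"
      using reals_Archimedean3[of "\<bar>d x\<bar>"] that by simp
    ultimately show ?thesis using not_le by blast
  qed
  have "d x = 0" if x: "l < x $ i" "x $ i \<le> r" for x
  proof (cases "x $ i \<le> r / 2")
    case False
    have "d ((1 / 2) *\<^sub>R x) = 0" using False x l by (intro lower) auto
    moreover have "d x = 2 * d ((1 / 2) *\<^sub>R x)"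
      using d_add[of "(1 / 2) *\<^sub>R x" "(1 / 2) *\<^sub>R x"] False x l
      by (simp flip: scaleR_add_left)
    ultimately show ?thesis by simp
  qed (use lower x in auto)
  then show ?thesis by (intro exI[of _ s]) (auto simp: d_def)
qed

section \<open>Subadditive functions modulo the lattice, and their uniqueness\<close>

definition gauge_function :: "(real ^ 'n \<Rightarrow> real) \<Rightarrow> bool" where
  "gauge_function \<rho> \<longleftrightarrow>
     (\<forall>x. 0 \<le> \<rho> x \<and> \<rho> x \<le> 1) \<and> (\<forall>x y. \<rho> (x + y) \<le> \<rho> x + \<rho> y) \<and>
     (\<forall>z\<in>integer_lattice. \<rho> z = 0)"

text \<open>Uniqueness among nonnegative functions that inherit the additive relations of
  \<open>\<rho>\<close>, the property behind facets. The normalization at \<open>\<beta>\<close> is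
  conditional so that the zero function, where the induction over coordinates starts,
  qualifies.\<close>

definition determined :: "real ^ 'n \<Rightarrow> (real ^ 'n \<Rightarrow> real) \<Rightarrow> bool" where
  "determined \<beta> \<rho> \<longleftrightarrow>
     (\<forall>\<rho>'. (\<forall>x. 0 \<le> \<rho>' x) \<longrightarrow>
        (\<forall>x y. \<rho> x + \<rho> y = \<rho> (x + y) \<longrightarrow> \<rho>' x + \<rho>' y = \<rho>' (x + y)) \<longrightarrow>
        (\<rho> \<beta> = 1 \<longrightarrow> \<rho>' \<beta> = 1) \<longrightarrow> \<rho>' = \<rho>)"

lemma integer_lattice_simps [simp]:
  "0 \<in> integer_lattice" "axis i 1 \<in> integer_lattice"
  "z \<in> integer_lattice \<Longrightarrow> - z \<in> integer_lattice"
  by (auto simp: integer_lattice_def axis_def)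

lemma gauge_function_periodic:
  assumes "gauge_function \<rho>" "z \<in> integer_lattice"
  shows "\<rho> (x + z) = \<rho> x"
proof -
  have "\<rho> (x + z) \<le> \<rho> x + \<rho> z" "\<rho> (x + z + - z) \<le> \<rho> (x + z) + \<rho> (- z)" "\<rho> z = 0" "\<rho> (- z) = 0"
    using assms unfolding gauge_function_def by (blast intro: integer_lattice_simps)+
  then show ?thesis by simp
qed

section \<open>Subadditivity of the function with one more coordinate\<close>

locale layer = profile b k for b k +
  fixes i :: "'n::finite" and \<rho> :: "real ^ 'n \<Rightarrow> real"
  assumes gauge: "gauge_function \<rho>"
    and indep: "\<And>x y. (\<And>j. j \<noteq> i \<Longrightarrow> x $ j = y $ j) \<Longrightarrow> \<rho> x = \<rho> y"
begin

abbreviation \<beta> :: "real ^ 'n" where "\<beta> \<equiv> vec b"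

text \<open>The function is scaled by \<open>b\<close>, so that the profile has slope one away from the teeth.\<close>

definition G :: "real ^ 'n \<Rightarrow> real" where
  "G x = (if x $ i \<in> \<int> then \<rho> x / 3 else if x $ i - b \<in> \<int> then b - \<rho> (\<beta> - x) / 3 else F (x $ i))"

lemma \<rho>_bounds: "0 \<le> \<rho> x" "\<rho> x \<le> 1" and \<rho>_subadd: "\<rho> (x + y) \<le> \<rho> x + \<rho> y"
  and \<rho>_lattice: "z \<in> integer_lattice \<Longrightarrow> \<rho> z = 0"
  using gauge by (auto simp: gauge_function_def)

lemma G_Ints: "x $ i \<in> \<int> \<Longrightarrow> G x = \<rho> x / 3"
  by (simp add: G_def)

lemma not_both_Ints: "\<not> (t \<in> \<int> \<and> t - b \<in> \<int>)"
  using b_notin_Ints Ints_diff[of t "t - b"] by auto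

lemma G_b: "x $ i - b \<in> \<int> \<Longrightarrow> G x = b - \<rho> (\<beta> - x) / 3"
  using not_both_Ints[of "x $ i"] by (auto simp: G_def)

lemma G_F: "x $ i \<notin> \<int> \<Longrightarrow> x $ i - b \<notin> \<int> \<Longrightarrow> G x = F (x $ i)"
  by (simp add: G_def)

lemma b_minus_Ints: "b - t \<in> \<int> \<longleftrightarrow> t - b \<in> \<int>"
  by (metis Ints_minus minus_diff_eq)

lemma G_sym: "G x + G (\<beta> - x) = b"
  using F_sym[of "x $ i"] not_both_Ints[of "x $ i"] by (auto simp: G_def b_minus_Ints)

lemma F_nonneg: "0 \<le> F t"
proof (cases "t \<in> \<int>")
  case True
  have "sawtooth w k b = 0" using w_eq w_le by (intro saw_outside) auto
  then show ?thesis using F_add_Ints[OF True, of 0] half_le saw_outside[of 0]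
    by (simp add: F_unit base_def step_def)
qed (use F_pos[of t] in simp)

lemma G_nonneg: "0 \<le> G x"
  using \<rho>_bounds[of x] \<rho>_bounds[of "\<beta> - x"] F_nonneg[of "x $ i"] half_le by (simp add: G_def)

text \<open>Periodicity turns the generic case into \<open>F_opposite\<close>. If one coordinate is
  \<open>b\<close> modulo \<open>1\<close>, then \<open>F_minus_b\<close> pays for the
  \<open>1 / 3\<close> that may be subtracted there; if both are,
  \<open>2 * b - 2 / 3 \<ge> 1 / 3\<close> suffices.\<close>

lemma G_opposite:
  assumes "x $ i + y $ i \<in> \<int>" "x $ i \<notin> \<int>"
  shows "1 / 3 \<le> G x + G y"
proof -
  have y: "y $ i \<notin> \<int>" using assms Ints_diff[of "x $ i + y $ i" "y $ i"] by auto
  have Fxy: "F (y $ i) = F (- x $ i)" "F (x $ i) = F (- y $ i)"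
    using F_add_Ints[OF assms(1), of "- x $ i"] F_add_Ints[OF assms(1), of "- y $ i"] by auto
  have *: "F (- t) = F (- b)" if "t - b \<in> \<int>" for t
    using F_add_Ints[OF that, of "- t"] by simp
  show ?thesis
    using \<rho>_bounds[of "\<beta> - x"] \<rho>_bounds[of "\<beta> - y"] F_opposite[OF assms(2)] F_minus_b half_le
      *[of "x $ i"] *[of "y $ i"] Fxy y assms(2) by (auto simp: G_def)
qed

text \<open>The deficit at \<open>x\<close> is \<open>\<rho> (y + z) / 3\<close>. On the subgroup it
  is covered by subadditivity of \<open>\<rho>\<close>, and off the subgroup by the
  \<open>1 / 3\<close> of \<open>G_opposite\<close>, as \<open>\<rho> \<le> 1\<close>.\<close>

lemma G_triple_b:
  assumes "x + y + z = \<beta>" "x $ i - b \<in> \<int>"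
  shows "b \<le> G x + G y + G z"
proof -
  have yz: "y + z = \<beta> - x" using assms(1) by (simp add: algebra_simps)
  have yzi: "y $ i + z $ i = b - x $ i" using arg_cong[OF yz, of "\<lambda>v. v $ i"] by simp
  then have int: "y $ i + z $ i \<in> \<int>" using assms(2) by (simp add: b_minus_Ints)
  show ?thesis
  proof (cases "y $ i \<in> \<int>")
    case True
    then have "z $ i \<in> \<int>" using Ints_diff[OF int True] by simp
    then show ?thesis using True \<rho>_subadd[of y z] by (simp add: G_Ints G_b[OF assms(2)] yz)
  next
    case False
    then show ?thesis
      using G_opposite[OF int False] \<rho>_bounds[of "\<beta> - x"] by (simp add: G_b[OF assms(2)])
  qed
qed

text \<open>If \<open>y\<close> or \<open>z\<close> lies in the translate, this is
  \<open>G_triple_b\<close> up to order. Otherwise both values come from \<open>F\<close>, with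
  \<open>F (z $ i) = F (b - y $ i)\<close>, and the symmetry of \<open>F\<close> already gives
  \<open>b\<close>.\<close>

lemma G_triple_Ints:
  assumes "x + y + z = \<beta>" "x $ i \<in> \<int>"
  shows "b \<le> G x + G y + G z"
proof (cases "y $ i - b \<in> \<int> \<or> z $ i - b \<in> \<int>")
  case True
  then show ?thesis using G_triple_b[of y x z] G_triple_b[of z x y] assms by (auto simp: algebra_simps)
next
  case False
  have sum: "x $ i + y $ i + z $ i = b" using arg_cong[OF assms(1), of "\<lambda>v. v $ i"] by simp
  have "y $ i \<notin> \<int>" "z $ i \<notin> \<int>"
  proof -
    show "y $ i \<notin> \<int>"
    proof
      assume "y $ i \<in> \<int>"
      moreover have "z $ i - b = - (x $ i + y $ i)" using sum by simp
      ultimately have "z $ i - b \<in> \<int>" using assms(2) by (simp only: Ints_minus Ints_add)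
      then show False using False by simp
    qed
    show "z $ i \<notin> \<int>"
    proof
      assume "z $ i \<in> \<int>"
      then have "- (x $ i + z $ i) \<in> \<int>" using assms(2) by (intro Ints_minus Ints_add)
      moreover have "- (x $ i + z $ i) = y $ i - b" using sum by simp
      ultimately show False using False by simp
    qed
  qed
  then have "G y = F (y $ i)" "G z = F (z $ i)" using False by (auto simp: G_F)
  moreover have "z $ i + x $ i = b - y $ i" using sum by simp
  then have "F (z $ i) = F (b - y $ i)" using F_add_Ints[OF assms(2), of "z $ i"] by simp
  ultimately show ?thesis using F_sym[of "y $ i"] G_nonneg[of x] by simp
qed

lemma G_triple:
  assumes "x + y + z = \<beta>"
  shows "b \<le> G x + G y + G z"
proof -
  have sum: "x $ i + y $ i + z $ i = b" using arg_cong[OF assms(1), of "\<lambda>v. v $ i"] by simp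
  consider "x $ i \<in> \<int> \<or> x $ i - b \<in> \<int>" | "y $ i \<in> \<int> \<or> y $ i - b \<in> \<int>" | "z $ i \<in> \<int> \<or> z $ i - b \<in> \<int>"
    | "G x = F (x $ i)" "G y = F (y $ i)" "G z = F (z $ i)" using G_F by blast
  then show ?thesis
  proof cases
    case 1
    then show ?thesis using assms G_triple_Ints[of x y z] G_triple_b[of x y z] by auto
  next
    case 2
    then show ?thesis using assms G_triple_Ints[of y x z] G_triple_b[of y x z] by (auto simp: algebra_simps)
  next
    case 3
    then show ?thesis using assms G_triple_Ints[of z x y] G_triple_b[of z x y] by (auto simp: algebra_simps)
  next
    case 4
    then show ?thesis using F_triple[OF sum] by simp
  qed
qed

lemma G_subadd: "G (x + y) \<le> G x + G y"
  using G_triple[of x y "\<beta> - (x + y)"] G_sym[of "x + y"] by simp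

lemma G_lattice: "z \<in> integer_lattice \<Longrightarrow> G z = 0"
  by (simp add: G_Ints \<rho>_lattice integer_lattice_def)

lemma G_zero:
  assumes "G x = 0"
  shows "x $ i \<in> \<int> \<and> \<rho> x = 0"
  using assms \<rho>_bounds[of "\<beta> - x"] F_pos[of "x $ i"] half_le by (auto simp: G_def split: if_splits)

lemma G_gauge: "gauge_function (\<lambda>x. G x / b)"
  unfolding gauge_function_def
proof (intro conjI allI ballI)
  fix x y :: "real ^ 'n"
  show "0 \<le> G x / b" using G_nonneg half_le by simp
  show "G x / b \<le> 1" using G_sym[of x] G_nonneg[of "\<beta> - x"] half_le by simp
  show "G (x + y) / b \<le> G x / b + G y / b"
    using divide_right_mono[OF G_subadd[of x y], of b] half_le by (simp add: add_divide_distrib)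
qed (simp add: G_lattice)

end

lemma axis_of_int_lattice: "axis i (of_int m) \<in> integer_lattice"
  by (auto simp: integer_lattice_def axis_def)

section \<open>Uniqueness: the additive relations of \<open>G\<close> force
  \<open>P = G\<close>\<close>

locale layer_additive = layer b k i \<rho> for b k and i :: "'n::finite" and \<rho> +
  fixes P :: "real ^ 'n \<Rightarrow> real"
  assumes det: "determined \<beta> \<rho>"
    and P_nonneg: "0 \<le> P x"
    and P_add: "G x + G y = G (x + y) \<Longrightarrow> P (x + y) = P x + P y"
    and P_top: "P \<beta> = b"
begin

lemma G_shift: "z \<in> integer_lattice \<Longrightarrow> G (x + z) = G x"
  using gauge_function_periodic[OF G_gauge] half_le by fastforce

lemma P_lattice:
  assumes "z \<in> integer_lattice"
  shows "P z = 0"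
proof -
  have "P 0 = 0" using P_add[of 0 0] G_lattice[of 0] by simp
  then have "P z + P (- z) = 0" using P_add[of z "- z"] assms by (simp add: G_lattice)
  then show ?thesis using P_nonneg[of z] P_nonneg[of "- z"] by linarith
qed

lemma P_shift: "z \<in> integer_lattice \<Longrightarrow> P (x + z) = P x"
  using P_add[of x z] by (simp add: P_lattice G_lattice G_shift)

lemma P_sym: "P x + P (\<beta> - x) = b"
proof -
  have "G \<beta> = b" using G_sym[of 0] G_lattice[of 0] by simp
  then show ?thesis using P_add[of x "\<beta> - x"] G_sym[of x] P_top by simp
qed

lemma P_abs_le: "\<bar>P x\<bar> \<le> b"
  using P_sym[of x] P_nonneg[of x] P_nonneg[of "\<beta> - x"] by linarith

lemma G_unit:
  assumes "0 < x $ i" "x $ i < 1" "x $ i \<noteq> b"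
  shows "G x = F (x $ i)"
proof (rule G_F)
  show "x $ i \<notin> \<int>" using assms Ints_nonzero_abs_less1[of "x $ i"] by auto
  have "\<bar>x $ i - b\<bar> < 1" using assms half_le less_one by linarith
  then show "x $ i - b \<notin> \<int>" using assms Ints_nonzero_abs_less1[of "x $ i - b"] by auto
qed

lemma G_mid: "w < x $ i \<Longrightarrow> x $ i < b - w \<Longrightarrow> G x = x $ i"
  using w_pos less_one by (simp add: G_unit F_mid)

lemma G_small: "0 < x $ i \<Longrightarrow> x $ i \<le> w \<Longrightarrow> G x = x $ i + sawtooth w k (x $ i)"
  using w_pos w_le w_eq by (simp add: G_unit F_small)

lemma G_plateau: "b + 6 * w \<le> x $ i \<Longrightarrow> x $ i \<le> 1 - 6 * w \<Longrightarrow> G x = x $ i - 1 / 2"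
  using w_pos half_le by (simp add: G_unit F_plateau)

lemma G_neg:
  assumes "- 6 * w < x $ i" "x $ i < 0"
  shows "G x = x $ i + 1 / 3"
  using assms w_pos w_le w_eq Ints_nonzero_abs_less1[of "x $ i"] Ints_nonzero_abs_less1[of "x $ i - b"]
  by (subst G_F) (auto simp: F_neg)

text \<open>\<open>G\<close> is the coordinate itself here, so \<open>P\<close> is additive and
  hence linear on a slab. The symmetry at coordinate \<open>b / 2\<close> forces slope one, and
  reflection covers the coordinates between \<open>b - 2 * w\<close> and
  \<open>b - w\<close>.\<close>

lemma P_mid:
  assumes "w < x $ i" "x $ i < b - w"
  shows "P x = x $ i"
proof -
  have "\<exists>s. \<forall>x. w < x $ i \<and> x $ i \<le> b - 2 * w \<longrightarrow> P x = s * x $ i"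
  proof (rule slab_additive_linear)
    show "P (x + y) = P x + P y" if "w < x $ i" "w < y $ i" "x $ i + y $ i \<le> b - 2 * w" for x y
      using that w_pos by (intro P_add) (simp add: G_mid)
  qed (use w_pos w_le w_eq P_abs_le in auto)
  then obtain s where s: "\<And>x. w < x $ i \<Longrightarrow> x $ i \<le> b - 2 * w \<Longrightarrow> P x = s * x $ i" by blast
  have "P (axis i (b / 2)) = s * (b / 2)" "P (\<beta> - axis i (b / 2)) = s * (b / 2)"
    using w_pos w_le w_eq by (subst s; simp)+
  moreover have "s * (b / 2) + s * (b / 2) = s * b" by simp
  ultimately have "s * b = b" using P_sym[of "axis i (b / 2)"] by linarith
  then have "s = 1" using half_le by simp
  then show ?thesis
    using s[of x] s[of "\<beta> - x"] P_sym[of x] assms w_pos w_le w_eq by (cases "x $ i \<le> b - 2 * w") auto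
qed

lemma P_neg:
  assumes "- 6 * w < x $ i" "x $ i < 0"
  shows "P x = x $ i + 1 / 3"
proof -
  \<comment> \<open>\<open>3 z\<close> is \<open>\<beta>\<close> modulo the lattice, which determines \<open>P z\<close>.\<close>
  define z where "z = (1 / 3) *\<^sub>R (\<beta> - axis i 1)"
  have zi: "z $ i = - 16 / 3 * w" using w_eq by (simp add: z_def)
  have zz: "\<beta> - (z + z) = z + axis i 1"
    by (simp add: z_def vec_eq_iff algebra_simps)
  have Gz: "G z = z $ i + 1 / 3" using zi w_pos by (intro G_neg) auto
  have "G (z + z) = b - G z" using G_sym[of "z + z"] G_shift[of "axis i 1" z] zz by simp
  then have "P (z + z) = P z + P z" using Gz zi w_eq by (intro P_add) simp
  moreover have "P (z + z) = b - P z" using P_sym[of "z + z"] P_shift[of "axis i 1" z] zz by simp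
  ultimately have Pz: "P z = z $ i + 1 / 3" using zi w_eq by simp
  \<comment> \<open>Here \<open>y\<close> is \<open>z\<close> plus a point with coordinate between
    \<open>w\<close> and \<open>16 / 3 * w\<close>, in the range of \<open>P_mid\<close>.\<close>
  have near: "P y = y $ i + 1 / 3" if y: "- 13 / 3 * w < y $ i" "y $ i < 0" for y
  proof -
    have "P (z + (y - z)) = P z + P (y - z)"
      using y zi Gz w_pos w_le w_eq G_neg[of y] by (intro P_add) (simp add: G_mid)
    moreover have "P (y - z) = (y - z) $ i" using y zi w_pos w_le w_eq by (intro P_mid) auto
    ultimately show ?thesis using Pz by simp
  qed
  show ?thesis
  proof (cases "- 13 / 3 * w < x $ i")
    case False
    \<comment> \<open>The shift \<open>3 * w\<close> is itself in the range of \<open>P_mid\<close>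
      and carries the rest into the range of \<open>near\<close>.\<close>
    have "P (x + axis i (3 * w)) = P x + P (axis i (3 * w))"
      using False assms w_pos w_le w_eq by (intro P_add) (simp add: G_mid G_neg)
    moreover have "P (axis i (3 * w)) = 3 * w" using w_pos w_le w_eq by (subst P_mid) auto
    moreover have "P (x + axis i (3 * w)) = x $ i + 3 * w + 1 / 3"
      using False assms w_pos by (subst near) auto
    ultimately show ?thesis by simp
  qed (use near assms in auto)
qed

text \<open>Doubling a point just above \<open>b + 6 * w\<close> lands, modulo the lattice, in the
  range of \<open>P_mid\<close>, and \<open>G\<close> doubles as well; this is an additive relation
  that fixes \<open>P\<close> there.\<close>

lemma P_plateau:
  assumes "b + 6 * w \<le> x $ i" "x $ i \<le> 1 - 6 * w"
  shows "P x = x $ i - 1 / 2"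
proof -
  have low: "P y = y $ i - 1 / 2" if y: "b + 6 * w \<le> y $ i" "y $ i < b + 15 / 2 * w" for y
  proof -
    define v where "v = y + y - axis i 1"
    have v: "w < v $ i" "v $ i < b - w" using y w_pos w_le w_eq by (auto simp: v_def)
    have yy: "y + y = v + axis i 1" by (simp add: v_def)
    have "G (y + y) = v $ i" "P (y + y) = v $ i"
      unfolding yy using v by (simp_all add: G_shift P_shift G_mid P_mid)
    moreover have "G y = y $ i - 1 / 2" using y w_pos w_eq by (intro G_plateau) auto
    ultimately show ?thesis using P_add[of y y] by (simp add: v_def)
  qed
  have mid: "P y = y $ i - 1 / 2" if y: "b + 6 * w \<le> y $ i" "y $ i < b + 9 * w" for y
  proof (cases "y $ i < b + 15 / 2 * w")
    case False
    \<comment> \<open>The length \<open>3 / 2 * w\<close> of the range of \<open>low\<close> exceeds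
      \<open>w\<close>, so shifting by it is covered by \<open>P_mid\<close>.\<close>
    define u where "u = axis i (3 / 2 * w)"
    have u: "u $ i = 3 / 2 * w" by (simp add: u_def)
    have "P (y - u + u) = P (y - u) + P u"
      using False y u w_pos w_le w_eq by (intro P_add) (simp add: G_mid G_plateau)
    moreover have "P u = 3 / 2 * w" using u w_pos w_le w_eq by (subst P_mid) auto
    moreover have "P (y - u) = y $ i - 3 / 2 * w - 1 / 2"
      using False y u by (subst low) auto
    ultimately show ?thesis by simp
  qed (use low y in auto)
  show ?thesis
  proof (cases "x $ i < b + 9 * w")
    case False
    \<comment> \<open>Reflection modulo the lattice maps coordinates from \<open>b + 9 * w\<close>
      to \<open>b + 10 * w\<close> onto those from \<open>b + 6 * w\<close> to
      \<open>b + 7 * w\<close>.\<close>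
    have "P (\<beta> - x) = P (\<beta> - x + axis i 1)" by (simp add: P_shift)
    also have "\<dots> = b - x $ i + 1 / 2"
      using False assms w_pos w_eq by (subst mid) auto
    finally show ?thesis using P_sym[of x] by simp
  qed (use mid assms in auto)
qed

lemma P_small:
  assumes "0 < x $ i" "x $ i \<le> w"
  shows "P x = G x"
proof -
  obtain j where j: "k = Suc j" using k_pos gr0_conv_Suc by blast
  obtain l r where lr: "0 \<le> l" "4 * l < r" "r \<le> w" "l < x $ i" "x $ i \<le> r"
    and saw: "\<And>s. l < s \<Longrightarrow> s \<le> r \<Longrightarrow> sawtooth w k s = s / (3 * r)"
    using sawtooth_piece[OF w_pos assms, of j] j by blast
  have Gs: "G y = y $ i + y $ i / (3 * r)" if "l < y $ i" "y $ i \<le> r" for y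
    using that lr by (simp add: G_small saw)
  have "\<exists>s. \<forall>y. l < y $ i \<and> y $ i \<le> r \<longrightarrow> P y = s * y $ i"
  proof (rule slab_additive_linear)
    show "P (y + z) = P y + P z" if "l < y $ i" "l < z $ i" "y $ i + z $ i \<le> r" for y z
      using that lr by (intro P_add) (simp add: Gs add_divide_distrib)
  qed (use lr P_abs_le in auto)
  then obtain s where s: "\<And>y. l < y $ i \<Longrightarrow> y $ i \<le> r \<Longrightarrow> P y = s * y $ i" by blast
  \<comment> \<open>The tip of a tooth is the sum of two points where \<open>P\<close> is already known.\<close>
  define u where "u = axis i (2 * w)"
  define v where "v = axis i r - u"
  have ui: "u $ i = 2 * w" and vi: "v $ i = r - 2 * w" by (simp_all add: u_def v_def)
  have "P (u + v) = P u + P v"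
  proof (rule P_add)
    have "G (u + v) = r + 1 / 3" using lr by (subst Gs) (auto simp: ui vi)
    then show "G u + G v = G (u + v)"
      using lr w_pos w_le w_eq by (simp add: G_mid G_neg ui vi)
  qed
  moreover have "P u = 2 * w" using w_pos w_le w_eq by (subst P_mid) (auto simp: ui)
  moreover have "P v = r - 2 * w + 1 / 3" using lr w_pos by (subst P_neg) (auto simp: vi)
  moreover have "P (u + v) = s * r" using lr by (subst s) (auto simp: ui vi)
  ultimately have "s * r = r + 1 / 3" by simp
  then have "s = 1 + 1 / (3 * r)" using lr by (simp add: field_simps)
  then show ?thesis using s[of x] Gs[of x] lr by (simp add: algebra_simps)
qed

text \<open>The ranges on either side of \<open>b\<close> are reflections of those on either side of
  \<open>0\<close>, and the range next to \<open>1\<close> is a lattice translate of the negative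
  one.\<close>

lemma P_unit:
  assumes "0 < x $ i" "x $ i < 1" "x $ i \<noteq> b"
  shows "P x = G x"
proof -
  consider "x $ i \<le> w" | "w < x $ i" "x $ i < b - w" | "b - w \<le> x $ i" "x $ i < b"
    | "b < x $ i" "x $ i < b + 6 * w" | "b + 6 * w \<le> x $ i" "x $ i \<le> 1 - 6 * w" | "1 - 6 * w < x $ i"
    using assms by linarith
  then show ?thesis
  proof cases
    case 3
    then have "P (\<beta> - x) = G (\<beta> - x)" by (intro P_small) auto
    then show ?thesis using P_sym[of x] G_sym[of x] by simp
  next
    case 4
    then have "P (\<beta> - x) = G (\<beta> - x)" by (subst P_neg) (auto simp: G_neg)
    then show ?thesis using P_sym[of x] G_sym[of x] by simp
  next
    case 6
    have x: "x = x - axis i 1 + axis i 1" by simp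
    have "P (x - axis i 1) = G (x - axis i 1)"
      using 6 assms by (subst P_neg) (auto simp: G_neg)
    then show ?thesis using x P_shift[of "axis i 1" "x - axis i 1"] G_shift[of "axis i 1" "x - axis i 1"] by simp
  qed (use assms in \<open>simp_all add: P_small P_mid G_mid P_plateau G_plateau\<close>)
qed

lemma P_F:
  assumes "x $ i \<notin> \<int>" "x $ i - b \<notin> \<int>"
  shows "P x = G x"
proof -
  let ?z = "axis i (of_int (- \<lfloor>x $ i\<rfloor>)) :: real ^ 'n"
  have fr: "(x + ?z) $ i = frac (x $ i)" by (simp add: frac_def)
  have "frac (x $ i) \<noteq> b"
  proof
    assume "frac (x $ i) = b"
    then have "x $ i - b = of_int \<lfloor>x $ i\<rfloor>" by (simp add: frac_def)
    then show False using assms(2) by simp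
  qed
  moreover have "0 < frac (x $ i)" using assms(1) by (simp add: frac_gt_0_iff)
  ultimately have "0 < (x + ?z) $ i" "(x + ?z) $ i < 1" "(x + ?z) $ i \<noteq> b"
    unfolding fr by (auto simp: frac_lt_1)
  then have "P (x + ?z) = G (x + ?z)" by (rule P_unit)
  then show ?thesis by (simp only: P_shift G_shift axis_of_int_lattice)
qed

lemma P_Ints:
  assumes "x $ i \<in> \<int>"
  shows "P x = G x"
proof -
  \<comment> \<open>The projection to \<open>x $ i = 0\<close>. As \<open>\<rho>\<close> ignores
    coordinate \<open>i\<close>, the function \<open>3 * P (Z y)\<close> of \<open>y\<close>
    inherits the additive relations of \<open>\<rho>\<close>.\<close>
  define Z :: "real ^ 'n \<Rightarrow> real ^ 'n" where "Z y = y - axis i (y $ i)" for y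
  have Zi: "Z y $ i = 0" for y by (simp add: Z_def)
  have Z_add: "Z (y + z) = Z y + Z z" for y z
    by (simp add: Z_def vec_eq_iff axis_def)
  have \<rho>Z: "\<rho> (Z y) = \<rho> y" for y by (rule indep) (simp add: Z_def axis_def)
  have GZ: "G (Z y) = \<rho> y / 3" for y by (simp add: G_Ints Zi \<rho>Z)
  have "(\<lambda>y. 3 * P (Z y)) = \<rho>"
  proof (rule det[unfolded determined_def, rule_format])
    show "0 \<le> 3 * P (Z y)" for y using P_nonneg by simp
    show "3 * P (Z y) + 3 * P (Z z) = 3 * P (Z (y + z))" if "\<rho> y + \<rho> z = \<rho> (y + z)" for y z
      using P_add[of "Z y" "Z z"] that by (simp add: GZ flip: Z_add)
    show "3 * P (Z \<beta>) = 1" if "\<rho> \<beta> = 1"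
    proof -
      \<comment> \<open>\<open>Z \<beta>\<close> splits into points with coordinates
        \<open>2 * w\<close> and \<open>- 2 * w\<close>, where \<open>P\<close> is known. Their
        values add up to the jump \<open>1 / 3\<close>, which equals \<open>G (Z \<beta>)\<close>
        when \<open>\<rho> \<beta> = 1\<close>.\<close>
      define u where "u = axis i (2 * w)"
      have ui: "u $ i = 2 * w" "(Z \<beta> - u) $ i = - 2 * w" by (simp_all add: u_def Zi)
      have "P (u + (Z \<beta> - u)) = P u + P (Z \<beta> - u)"
        using that w_pos w_le w_eq ui GZ[of \<beta>] by (intro P_add) (simp add: G_mid G_neg)
      then show ?thesis using w_pos w_le w_eq ui by (simp add: P_mid P_neg)
    qed
  qed
  then have "3 * P (Z x) = \<rho> x" by meson
  moreover have "P (Z x + axis i (x $ i)) = P (Z x)"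
    using assms by (intro P_shift) (auto simp: integer_lattice_def axis_def)
  ultimately show ?thesis by (simp add: Z_def G_Ints assms)
qed

lemma P_eq: "P x = G x"
proof (cases "x $ i - b \<in> \<int>")
  case True
  then have "P (\<beta> - x) = G (\<beta> - x)" by (intro P_Ints) (simp add: b_minus_Ints)
  then show ?thesis using P_sym[of x] G_sym[of x] by simp
qed (use P_F P_Ints in auto)

end

lemma (in layer) determined_G:
  assumes "determined \<beta> \<rho>"
  shows "determined \<beta> (\<lambda>x. G x / b)"
  unfolding determined_def
proof (intro allI impI)
  fix \<pi>' :: "real ^ 'n \<Rightarrow> real"
  assume nonneg: "\<forall>x. 0 \<le> \<pi>' x"
    and add: "\<forall>x y. G x / b + G y / b = G (x + y) / b \<longrightarrow> \<pi>' x + \<pi>' y = \<pi>' (x + y)"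
    and top: "G \<beta> / b = 1 \<longrightarrow> \<pi>' \<beta> = 1"
  have b: "0 < b" using half_le by simp
  interpret layer_additive b k i \<rho> "\<lambda>x. b * \<pi>' x"
  proof
    show "b * \<pi>' (x + y) = b * \<pi>' x + b * \<pi>' y" if "G x + G y = G (x + y)" for x y
      using add[rule_format, of x y] that by (simp add: add_divide_distrib[symmetric] distrib_left[symmetric])
    have "G \<beta> = b" using G_sym[of 0] G_lattice[of 0] by simp
    then show "b * \<pi>' \<beta> = b" using top b by simp
  qed (use assms nonneg b in auto)
  show "\<pi>' = (\<lambda>x. G x / b)"
    using P_eq b by (auto simp: field_simps)
qed

section \<open>From gauges to facets\<close>

lemma gauge_function_sum:
  assumes \<pi>: "gauge_function \<pi>" and "finite A"
  shows "\<pi> (\<Sum>r\<in>A. real (y r) *\<^sub>R r) \<le> (\<Sum>r\<in>A. \<pi> r * real (y r))"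
proof -
  have zero: "\<pi> 0 = 0" and subadd: "\<pi> (u + v) \<le> \<pi> u + \<pi> v" for u v
    using \<pi> by (auto simp: gauge_function_def)
  have scale: "\<pi> (real n *\<^sub>R r) \<le> \<pi> r * real n" for n r
  proof (induction n)
    case (Suc n)
    then show ?case using subadd[of r "real n *\<^sub>R r"] by (simp add: algebra_simps)
  qed (simp add: zero)
  from \<open>finite A\<close> show ?thesis
  proof induction
    case (insert r A)
    then show ?case
      using subadd[of "real (y r) *\<^sub>R r" "\<Sum>r\<in>A. real (y r) *\<^sub>R r"] scale[of "y r" r] by simp
  qed (simp add: zero)
qed

text \<open>Multisets stand for functions of finite support, so that coinciding points in a tight
  sum are counted with multiplicity.\<close>

lemma sum_count_scaleR:
  fixes f :: "'a \<Rightarrow> 'b::real_vector"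
  shows "(\<Sum>r | count M r \<noteq> 0. real (count M r) *\<^sub>R f r) = (\<Sum>r\<in>#M. f r)"
proof -
  \<comment> \<open>A fixed superset \<open>A\<close> of the support keeps the index set constant
    during the induction.\<close>
  have "(\<Sum>r\<in>A. real (count M r) *\<^sub>R f r) = (\<Sum>r\<in>#M. f r)" if "finite A" "set_mset M \<subseteq> A" for A
    using that(2)
  proof (induction M)
    case (add x M)
    have "(\<Sum>r\<in>A. real (count (add_mset x M) r) *\<^sub>R f r) =
        (\<Sum>r\<in>A. (if r = x then f r else 0) + real (count M r) *\<^sub>R f r)"
      by (intro sum.cong) (auto simp: algebra_simps)
    then show ?case using add that(1) by (simp add: sum.distrib)
  qed simp
  then show ?thesis by (simp flip: set_mset_def)
qed

lemma count_in_tight_set: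
  "count M \<in> tight_set \<beta> \<pi> \<longleftrightarrow>
     (\<exists>z\<in>integer_lattice. (\<Sum>r\<in>#M. r) = \<beta> + z) \<and> (\<Sum>r\<in>#M. \<pi> r) = 1"
proof -
  have "finite {r. count M r \<noteq> 0}" by (simp flip: set_mset_def)
  then show ?thesis
    using sum_count_scaleR[of M "\<lambda>r. r"] sum_count_scaleR[of M \<pi>]
    by (simp add: tight_set_def group_relaxation_def cut_value_def mult.commute)
qed

text \<open>Validity is subadditivity along finite sums together with
  \<open>\<pi> \<beta> = 1\<close>. Where \<open>\<pi>\<close> is additive at \<open>x\<close> and
  \<open>y\<close>, the multisets \<open>{#x, y, \<beta> - (x + y)#}\<close> and
  \<open>{#x + y, \<beta> - (x + y)#}\<close> are both tight; subtracting the two equations for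
  \<open>\<pi>'\<close> shows that it is additive there too.\<close>

lemma facet_function_if_determined:
  assumes \<pi>: "gauge_function \<pi>" and det: "determined \<beta> \<pi>"
    and sym: "\<And>x. \<pi> x + \<pi> (\<beta> - x) = 1"
    and \<beta>: "\<beta> = \<gamma> + z" "z \<in> integer_lattice"
  shows "facet_function \<gamma> \<pi>"
  unfolding facet_function_def valid_function_def
proof (intro conjI allI ballI impI)
  show "0 \<le> \<pi> r" for r using \<pi> by (simp add: gauge_function_def)
  show "1 \<le> cut_value \<pi> y" if y: "y \<in> group_relaxation \<gamma>" for y
  proof -
    obtain z' where z': "z' \<in> integer_lattice" "(\<Sum>r | y r \<noteq> 0. real (y r) *\<^sub>R r) = \<gamma> + z'"
      using y by (auto simp: group_relaxation_def)
    have "\<pi> 0 = 0" using \<pi> by (simp add: gauge_function_def)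
    then have "1 = \<pi> \<beta>" using sym[of 0] by simp
    also have "\<dots> = \<pi> (\<gamma> + z')"
      using gauge_function_periodic[OF \<pi>] \<beta> z'(1) by metis
    also have "\<dots> \<le> cut_value \<pi> y"
      using gauge_function_sum[OF \<pi>, of "{r. y r \<noteq> 0}" y] y z'(2)
      by (simp add: cut_value_def group_relaxation_def)
    finally show ?thesis .
  qed
next
  fix \<pi>' assume valid: "(\<forall>r. 0 \<le> \<pi>' r) \<and> (\<forall>y\<in>group_relaxation \<gamma>. 1 \<le> cut_value \<pi>' y)"
    and tight: "tight_set \<gamma> \<pi> \<subseteq> tight_set \<gamma> \<pi>'"
  have eq1: "(\<Sum>r\<in>#M. \<pi>' r) = 1" if "(\<Sum>r\<in>#M. r) = \<beta>" "(\<Sum>r\<in>#M. \<pi> r) = 1" for M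
  proof -
    have "count M \<in> tight_set \<gamma> \<pi>" unfolding count_in_tight_set using that \<beta> by auto
    then show ?thesis using tight count_in_tight_set by blast
  qed
  have "\<pi>' = \<pi>"
  proof (rule det[unfolded determined_def, rule_format])
    show "0 \<le> \<pi>' x" for x using valid by simp
    show "\<pi>' x + \<pi>' y = \<pi>' (x + y)" if "\<pi> x + \<pi> y = \<pi> (x + y)" for x y
      using eq1[of "{#x, y, \<beta> - (x + y)#}"] eq1[of "{#x + y, \<beta> - (x + y)#}"] sym[of "x + y"] that
      by simp
    show "\<pi>' \<beta> = 1" if "\<pi> \<beta> = 1" using eq1[of "{#\<beta>#}"] that by simp
  qed
  then show "\<pi> = \<pi>'" ..
qed

text \<open>Two cut values of at least one whose average is one are both one, so
  \<open>\<pi>1\<close> and \<open>\<pi>2\<close> inherit the tight set.\<close>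

lemma extreme_function_if_facet:
  assumes "facet_function \<beta> \<pi>"
  shows "extreme_function \<beta> \<pi>"
  unfolding extreme_function_def
proof (intro conjI allI impI)
  show "valid_function \<beta> \<pi>" using assms by (simp add: facet_function_def)
  fix \<pi>1 \<pi>2
  assume valid: "valid_function \<beta> \<pi>1" "valid_function \<beta> \<pi>2" and avg: "\<pi> = (\<lambda>r. (\<pi>1 r + \<pi>2 r) / 2)"
  have avg_cut: "2 * cut_value \<pi> y = cut_value \<pi>1 y + cut_value \<pi>2 y" for y
    by (auto simp: avg cut_value_def sum_distrib_left sum.distrib[symmetric] field_simps intro!: sum.cong)
  have "cut_value \<pi>1 y = 1 \<and> cut_value \<pi>2 y = 1" if "y \<in> tight_set \<beta> \<pi>" for y
  proof -
    have "y \<in> group_relaxation \<beta>" "cut_value \<pi> y = 1" using that by (auto simp: tight_set_def)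
    moreover from this have "1 \<le> cut_value \<pi>1 y" "1 \<le> cut_value \<pi>2 y"
      using valid by (auto simp: valid_function_def)
    ultimately show ?thesis using avg_cut[of y] by linarith
  qed
  then have "tight_set \<beta> \<pi> \<subseteq> tight_set \<beta> \<pi>1" "tight_set \<beta> \<pi> \<subseteq> tight_set \<beta> \<pi>2"
    by (auto simp: tight_set_def)
  then have "\<pi> = \<pi>1" "\<pi> = \<pi>2" using assms valid unfolding facet_function_def by blast+
  then show "\<pi> = \<pi>1" "\<pi>1 = \<pi>2" by simp_all
qed

text \<open>A factorization through a smaller dimension makes \<open>\<theta>\<close> constant along
  some line through the origin. All of that line would then consist of zeros, hence of lattice
  points.\<close>

lemma genuinely_full_dimensional_if_zeros:
  fixes \<theta> :: "real ^ 'n \<Rightarrow> real"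
  assumes "\<theta> 0 = 0" and zeros: "\<And>x. \<theta> x = 0 \<Longrightarrow> x \<in> integer_lattice"
  shows "genuinely_full_dimensional \<theta>"
  unfolding genuinely_full_dimensional_def
proof
  assume "\<exists>(T :: real ^ 'n \<Rightarrow> nat \<Rightarrow> real) \<theta>'.
    (\<forall>x. T x \<in> topspace (Euclidean_space (CARD('n) - 1))) \<and> (\<forall>i. linear (\<lambda>x. T x i)) \<and> \<theta> = \<theta>' \<circ> T"
  then obtain T :: "real ^ 'n \<Rightarrow> nat \<Rightarrow> real" and \<theta>' where
    T: "\<And>x i. CARD('n) - 1 \<le> i \<Longrightarrow> T x i = 0" and lin: "\<And>i. linear (\<lambda>x. T x i)" and \<theta>: "\<theta> = \<theta>' \<circ> T"
    by (auto simp: topspace_Euclidean_space)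
  obtain e :: "'n \<Rightarrow> nat" where e: "bij_betw e UNIV {0..<CARD('n)}"
    using ex_bij_betw_finite_nat[of "UNIV :: 'n set"] by auto
  \<comment> \<open>\<open>g\<close> copies \<open>T\<close> into the domain. Its component with
    index \<open>CARD('n) - 1\<close> vanishes, so \<open>g\<close> is not surjective and has a
    nontrivial kernel.\<close>
  define g :: "real ^ 'n \<Rightarrow> real ^ 'n" where "g x = (\<chi> j. T x (e j))" for x
  have "linear g" using lin by (auto simp: g_def linear_iff vec_eq_iff)
  have "CARD('n) - 1 \<in> e ` UNIV" using e by (auto simp: bij_betw_def)
  then obtain j where "e j = CARD('n) - 1" by auto
  then have "g x \<noteq> axis j 1" for x
    using T[of "e j" x] by (auto simp: g_def vec_eq_iff axis_def)
  then have "\<not> inj g" using linear_injective_imp_surjective[OF \<open>linear g\<close>] by (metis surjE)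
  then obtain v where v: "v \<noteq> 0" "g v = 0"
    using linear_injective_0[OF \<open>linear g\<close>] by blast
  have Tv: "T (c *\<^sub>R v) = T 0" for c
  proof
    fix i
    have "T v i = 0"
    proof (cases "i < CARD('n)")
      case True
      then obtain j' where "i = e j'" using e by (metis atLeastLessThan_iff bij_betw_imp_surj_on imageE le0)
      then show ?thesis using v(2) by (auto simp: g_def vec_eq_iff)
    qed (simp add: T)
    then show "T (c *\<^sub>R v) i = T 0 i"
      by (simp add: linear_cmul[OF lin] linear_0[OF lin])
  qed
  have lattice: "c *\<^sub>R v \<in> integer_lattice" for c
    using assms(1) by (intro zeros) (simp add: \<theta> Tv)
  obtain j where "v $ j \<noteq> 0" using v(1) by (auto simp: vec_eq_iff)
  then have "((1 / (2 * v $ j)) *\<^sub>R v) $ j = 1 / 2" by simp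
  moreover have "(1 / 2 :: real) \<notin> \<int>" using Ints_nonzero_abs_less1[of "1 / 2 :: real"] by auto
  ultimately show False using lattice by (metis (mono_tags, lifting) integer_lattice_def mem_Collect_eq)
qed

section \<open>Functions of one coordinate away from hyperplanes\<close>

definition slab :: "'n \<Rightarrow> real \<Rightarrow> real \<Rightarrow> (real ^ 'n) set" where
  "slab i u v = {x. u \<le> x $ i \<and> x $ i \<le> v}"

lemma polyhedron_slab: "polyhedron (slab i u v)"
proof -
  have "slab i u v = {x. axis i 1 \<bullet> x \<le> v} \<inter> {x. axis i 1 \<bullet> x \<ge> u}"
    by (auto simp: slab_def inner_axis')
  then show ?thesis by (simp add: polyhedron_Int polyhedron_halfspace_le polyhedron_halfspace_ge)
qed

lemma slab_face:
  assumes "c = u \<or> c = v" "u \<le> v"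
  shows "slab i c c face_of slab i u v"
proof -
  have conv: "convex (slab i u v)" by (simp add: polyhedron_slab polyhedron_imp_convex)
  have eq: "slab i u u = slab i u v \<inter> {x. axis i 1 \<bullet> x = u}"
    "slab i v v = slab i u v \<inter> {x. axis i 1 \<bullet> x = v}"
    using assms(2) by (auto simp: slab_def inner_axis')
  have "slab i u u face_of slab i u v"
    unfolding eq(1) by (rule face_of_Int_supporting_hyperplane_ge[OF conv]) (simp add: slab_def inner_axis')
  moreover have "slab i v v face_of slab i u v"
    unfolding eq(2) by (rule face_of_Int_supporting_hyperplane_le[OF conv]) (simp add: slab_def inner_axis')
  ultimately show ?thesis using assms(1) by auto
qed

lemma interior_slab:
  assumes "x \<in> interior (slab i u v)"
  shows "u < x $ i \<and> x $ i < v"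
proof -
  have "interior (slab i u v) \<subseteq> interior {x. u \<le> x $ i} \<inter> interior {x. x $ i \<le> v}"
    unfolding interior_Int[symmetric] by (intro interior_mono) (auto simp: slab_def)
  then show ?thesis
    using assms interior_halfspace_component_le[of i v] interior_halfspace_component_ge[of u i] by auto
qed

text \<open>The case \<open>u = v\<close> contributes the bounding hyperplanes; together with the
  empty set they close the collection under intersection.\<close>

definition slab_complex :: "'n \<Rightarrow> real set \<Rightarrow> (real ^ 'n) set set" where
  "slab_complex i L =
     insert {} {slab i u v | u v. u \<in> L \<and> v \<in> L \<and> u \<le> v \<and> {u<..<v} \<inter> L = {}}"

text \<open>An end point of one slab is in \<open>L\<close> and thus never strictly between the end
  points of the other.\<close>

lemma slab_complex_Int:
  assumes "u \<in> L" "v \<in> L" "u \<le> v" "{u<..<v} \<inter> L = {}"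
    and "u' \<in> L" "v' \<in> L" "u' \<le> v'" "{u'<..<v'} \<inter> L = {}"
  shows "slab i u v \<inter> slab i u' v' = {} \<or> u = u' \<and> v = v' \<or>
    (\<exists>c\<in>{u, v} \<inter> {u', v'}. slab i u v \<inter> slab i u' v' = slab i c c)"
proof -
  have gaps: "\<not> (u < u' \<and> u' < v)" "\<not> (u' < u \<and> u < v')" "\<not> (u < v' \<and> v' < v)" "\<not> (u' < v \<and> v < v')"
    using assms by auto
  have int: "slab i u v \<inter> slab i u' v' = slab i (max u u') (min v v')" by (auto simp: slab_def)
  consider "max u u' > min v v'" | "u = u' \<and> v = v'" | "max u u' = min v v'" "max u u' \<in> {u, v} \<inter> {u', v'}"
    using gaps assms(3,7) by (smt (verit) IntI insert_iff)
  then show ?thesis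
  proof cases
    case 1
    then show ?thesis unfolding int by (auto simp: slab_def)
  next
    case 3
    then show ?thesis unfolding int by (metis)
  qed simp
qed

lemma regular_slab_complex:
  fixes i :: "'n::finite"
  assumes Ints: "\<int> \<subseteq> L" and fin: "\<And>a c. finite (L \<inter> {a..c})"
  shows "regular_polyhedral_complex (slab_complex i L)"
  unfolding regular_polyhedral_complex_def
proof (intro conjI ballI allI impI)
  show "polyhedron P" if "P \<in> slab_complex i L" for P
    using that by (auto simp: slab_complex_def polyhedron_slab)
  have cover: "\<exists>u v. u \<in> L \<and> v \<in> L \<and> u \<le> v \<and> {u<..<v} \<inter> L = {} \<and> x \<in> slab i u v" for x :: "real ^ 'n"
  proof -
    let ?t = "x $ i"
    \<comment> \<open>The nearest points of \<open>L\<close> on either side are sought between floor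
      and ceiling, which are in \<open>L\<close>. Both equal \<open>x $ i\<close> if it is in
      \<open>L\<close>.\<close>
    define A where "A = L \<inter> {of_int \<lfloor>?t\<rfloor>..?t}"
    define C where "C = L \<inter> {?t..of_int \<lceil>?t\<rceil>}"
    have "of_int \<lfloor>?t\<rfloor> \<in> A" "of_int \<lceil>?t\<rceil> \<in> C"
      using Ints Ints_of_int by (auto simp: A_def C_def)
    then have A: "finite A" "A \<noteq> {}" and C: "finite C" "C \<noteq> {}"
      using fin unfolding A_def C_def by blast+
    have "Max A \<in> A" "Min C \<in> C" using A C by auto
    then have mem: "Max A \<in> L" "Max A \<le> ?t" "of_int \<lfloor>?t\<rfloor> \<le> Max A" "Min C \<in> L" "?t \<le> Min C" "Min C \<le> of_int \<lceil>?t\<rceil>"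
      by (auto simp: A_def C_def)
    have "s \<notin> L" if "Max A < s" "s < Min C" for s
    proof
      assume "s \<in> L"
      then have "s \<in> A \<or> s \<in> C" using that mem by (auto simp: A_def C_def)
      then show False using that A C Max_ge Min_le by (meson not_le)
    qed
    then show ?thesis using mem by (intro exI[of _ "Max A"] exI[of _ "Min C"]) (auto simp: slab_def)
  qed
  have "x \<in> \<Union> (slab_complex i L)" for x :: "real ^ 'n"
  proof -
    obtain u v where uv: "u \<in> L" "v \<in> L" "u \<le> v" "{u<..<v} \<inter> L = {}" "x \<in> slab i u v"
      using cover by blast
    then have "slab i u v \<in> slab_complex i L"
      unfolding slab_complex_def by (intro insertI2 CollectI exI[of _ u] exI[of _ v]) simp
    then show ?thesis using uv(5) by (rule UnionI)
  qed
  then show "\<Union> (slab_complex i L) = UNIV" by blast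
next
  fix P Q assume P: "P \<in> slab_complex i L" and Q: "Q \<in> slab_complex i L"
  have "(P \<inter> Q) face_of P \<and> (P \<inter> Q) face_of Q \<and> P \<inter> Q \<in> slab_complex i L"
  proof (cases "P \<inter> Q = {}")
    case False
    then obtain u v u' v' where P': "P = slab i u v" "u \<in> L" "v \<in> L" "u \<le> v" "{u<..<v} \<inter> L = {}"
      and Q': "Q = slab i u' v'" "u' \<in> L" "v' \<in> L" "u' \<le> v'" "{u'<..<v'} \<inter> L = {}"
      using P Q by (auto simp: slab_complex_def)
    from slab_complex_Int[OF P'(2-5) Q'(2-5), of i] False consider "P = Q"
      | c where "c \<in> {u, v}" "c \<in> {u', v'}" "P \<inter> Q = slab i c c"
      unfolding P'(1) Q'(1) by blast
    then show ?thesis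
    proof cases
      case 1
      then show ?thesis
        using Q by (auto simp: Q'(1) face_of_refl polyhedron_slab polyhedron_imp_convex)
    next
      case 2
      then have "c \<in> L" using P' by auto
      then have "slab i c c \<in> slab_complex i L"
        unfolding slab_complex_def by (intro insertI2 CollectI exI[of _ c]) simp
      then show ?thesis using 2 slab_face[of c u v i] slab_face[of c u' v' i] P' Q' by auto
    qed
  qed (simp add: slab_complex_def)
  then show "(P \<inter> Q) face_of P" "(P \<inter> Q) face_of Q" "P \<inter> Q \<in> slab_complex i L" by auto
next
  fix B :: "(real ^ 'n) set" assume "bounded B"
  then obtain a where a: "\<And>x. x \<in> B \<Longrightarrow> norm x \<le> a" by (auto simp: bounded_iff)
  let ?K = "L \<inter> {- a - 1..a + 1}"
  have "{P \<in> slab_complex i L. P \<inter> B \<noteq> {}} \<subseteq> (\<lambda>(u, v). slab i u v) ` (?K \<times> ?K)"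
  proof
    fix P assume "P \<in> {P \<in> slab_complex i L. P \<inter> B \<noteq> {}}"
    then obtain u v x where uv: "P = slab i u v" "u \<in> L" "v \<in> L" "u \<le> v" "{u<..<v} \<inter> L = {}"
      and x: "x \<in> B" "u \<le> x $ i" "x $ i \<le> v"
      by (auto simp: slab_complex_def) (auto simp: slab_def)
    \<comment> \<open>Since \<open>L\<close> contains the integers, slabs have width at most one, so
      a slab that meets \<open>B\<close> has both ends in \<open>?K\<close>.\<close>
    have "of_int (\<lfloor>u\<rfloor> + 1) \<in> L" using Ints Ints_of_int by blast
    moreover have "u < of_int (\<lfloor>u\<rfloor> + 1)" by linarith
    ultimately have "\<not> of_int (\<lfloor>u\<rfloor> + 1) < v"
      using uv(5) unfolding disjoint_iff greaterThanLessThan_iff by blast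
    then have "v \<le> u + 1" by linarith
    moreover have "\<bar>x $ i\<bar> \<le> a" using a[OF x(1)] component_le_norm_cart[of x i] by linarith
    ultimately have "u \<in> ?K" "v \<in> ?K" using uv x by auto
    then show "P \<in> (\<lambda>(u, v). slab i u v) ` (?K \<times> ?K)" using uv(1) by auto
  qed
  then show "finite {P \<in> slab_complex i L. P \<inter> B \<noteq> {}}"
    using fin by (meson finite_SigmaI finite_imageI finite_subset)
qed

text \<open>Affine behaviour is required only on open slabs, because on some hyperplanes over
  \<open>L\<close> the function \<open>G\<close> depends on the other coordinates.\<close>

definition ridge_function :: "'n \<Rightarrow> nat \<Rightarrow> (real ^ 'n \<Rightarrow> real) \<Rightarrow> bool" where
  "ridge_function i k \<theta> \<longleftrightarrow>
     (\<exists>L. \<int> \<subseteq> L \<and> (\<forall>a c. finite (L \<inter> {a..c})) \<and>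
        (\<forall>u v. u < v \<longrightarrow> {u<..<v} \<inter> L = {} \<longrightarrow>
           (\<exists>\<alpha> \<gamma>. \<forall>x. u < x $ i \<and> x $ i < v \<longrightarrow> \<theta> x = \<alpha> * x $ i + \<gamma>))) \<and>
     (\<exists>S. finite S \<and> card S = k \<and>
        (\<forall>\<alpha>\<in>S. \<exists>u v \<gamma>. u < v \<and> (\<forall>x. u < x $ i \<and> x $ i < v \<longrightarrow> \<theta> x = \<alpha> * x $ i + \<gamma>)))"

lemma ridge_function_uminus:
  assumes "ridge_function i k \<theta>"
  shows "ridge_function i k (\<lambda>x. \<theta> (- x))"
proof -
  obtain L S where L: "\<int> \<subseteq> L" "\<And>a c. finite (L \<inter> {a..c})"
    and aff: "\<And>u v. u < v \<Longrightarrow> {u<..<v} \<inter> L = {} \<Longrightarrow>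
       \<exists>\<alpha> \<gamma>. \<forall>x. u < x $ i \<and> x $ i < v \<longrightarrow> \<theta> x = \<alpha> * x $ i + \<gamma>"
    and S: "finite S" "card S = k" "\<And>\<alpha>. \<alpha> \<in> S \<Longrightarrow> \<exists>u v \<gamma>. u < v \<and> (\<forall>x. u < x $ i \<and> x $ i < v \<longrightarrow> \<theta> x = \<alpha> * x $ i + \<gamma>)"
    using assms unfolding ridge_function_def by metis
  have reflect: "\<forall>x. u < x $ i \<and> x $ i < v \<longrightarrow> \<theta> (- x) = - \<alpha> * x $ i + \<gamma>"
    if "\<forall>x. - v < x $ i \<and> x $ i < - u \<longrightarrow> \<theta> x = \<alpha> * x $ i + \<gamma>" for u v \<alpha> \<gamma>
  proof (intro allI impI)
    fix x assume "u < x $ i \<and> x $ i < v"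
    then show "\<theta> (- x) = - \<alpha> * x $ i + \<gamma>" using that[rule_format, of "- x"] by simp
  qed
  show ?thesis unfolding ridge_function_def
  proof (rule conjI[OF exI[of _ "uminus ` L"] exI[of _ "uminus ` S"]]; intro conjI allI ballI impI)
    show "\<int> \<subseteq> uminus ` L"
    proof
      fix t :: real assume "t \<in> \<int>"
      then have "- t \<in> L" using L(1) by auto
      then show "t \<in> uminus ` L" by (metis image_eqI minus_minus)
    qed
    have "uminus ` L \<inter> {a..c} = uminus ` (L \<inter> {- c..- a})" for a c by auto
    then show "finite (uminus ` L \<inter> {a..c})" for a c using L(2) by simp
    fix u v :: real assume "u < v" "{u<..<v} \<inter> uminus ` L = {}"
    moreover have "{- v<..<- u} \<inter> L = {}"
    proof (rule ccontr)
      assume "{- v<..<- u} \<inter> L \<noteq> {}"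
      then obtain t where "t \<in> L" "u < - t" "- t < v" by force
      then have "- t \<in> {u<..<v} \<inter> uminus ` L" by simp
      then show False using \<open>{u<..<v} \<inter> uminus ` L = {}\<close> by blast
    qed
    ultimately show "\<exists>\<alpha> \<gamma>. \<forall>x. u < x $ i \<and> x $ i < v \<longrightarrow> \<theta> (- x) = \<alpha> * x $ i + \<gamma>"
      using aff[of "- v" "- u"] reflect by (metis neg_less_iff_less)
  next
    show "finite (uminus ` S)" "card (uminus ` S) = k" using S by (auto simp: card_image inj_on_def)
    fix \<alpha> assume "\<alpha> \<in> uminus ` S"
    then obtain u v \<gamma> where "u < v" "\<forall>x. u < x $ i \<and> x $ i < v \<longrightarrow> \<theta> x = - \<alpha> * x $ i + \<gamma>"
      using S(3) by force
    then show "\<exists>u v \<gamma>. u < v \<and> (\<forall>x. u < x $ i \<and> x $ i < v \<longrightarrow> \<theta> (- x) = \<alpha> * x $ i + \<gamma>)"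
      using reflect[of "- u" "- v" "- \<alpha>" \<gamma>] by (intro exI[of _ "- v"] exI[of _ "- u"] exI[of _ \<gamma>]) simp
  qed
qed

lemma slope_on_slab:
  fixes \<theta> :: "real ^ 'n \<Rightarrow> real"
  assumes "u < v" "\<And>x. u < x $ i \<Longrightarrow> x $ i < v \<Longrightarrow> \<theta> x = \<alpha> * x $ i + \<gamma>"
  shows "\<alpha> *\<^sub>R axis i 1 \<in> slopes \<theta>"
proof -
  define x0 :: "real ^ 'n" where "x0 = axis i ((u + v) / 2)"
  let ?S = "{x :: real ^ 'n. u < x $ i} \<inter> {x. x $ i < v}"
  have "((\<lambda>x. \<alpha> * x $ i + \<gamma>) has_derivative (\<lambda>h. h \<bullet> (\<alpha> *\<^sub>R axis i 1))) (at x0)"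
    by (auto intro!: derivative_eq_intros bounded_linear_imp_has_derivative bounded_linear_vec_nth
        simp: inner_axis)
  moreover have "open ?S" by (intro open_Int open_halfspace_component_gt_cart open_halfspace_component_lt_cart)
  ultimately have "(\<theta> has_derivative (\<lambda>h. h \<bullet> (\<alpha> *\<^sub>R axis i 1))) (at x0)"
    by (rule has_derivative_transform_within_open) (use assms in \<open>auto simp: x0_def\<close>)
  then show ?thesis by (auto simp: slopes_def gderiv_def)
qed

lemma ridge_function_slopes:
  fixes \<theta> :: "real ^ 'n \<Rightarrow> real"
  assumes "ridge_function i k \<theta>"
  shows "has_at_least_slopes k \<theta>"
proof -
  obtain L S where L: "\<int> \<subseteq> L" "\<And>a c. finite (L \<inter> {a..c})"
    and aff: "\<And>u v. u < v \<Longrightarrow> {u<..<v} \<inter> L = {} \<Longrightarrow>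
       \<exists>\<alpha> \<gamma>. \<forall>x. u < x $ i \<and> x $ i < v \<longrightarrow> \<theta> x = \<alpha> * x $ i + \<gamma>"
    and S: "finite S" "card S = k" "\<And>\<alpha>. \<alpha> \<in> S \<Longrightarrow> \<exists>u v \<gamma>. u < v \<and> (\<forall>x. u < x $ i \<and> x $ i < v \<longrightarrow> \<theta> x = \<alpha> * x $ i + \<gamma>)"
    using assms unfolding ridge_function_def by metis
  have "\<exists>a c. \<forall>x\<in>interior P. \<theta> x = a \<bullet> x + c" if mem: "P \<in> slab_complex i L" for P
  proof (cases "interior P = {}")
    case False
    then have "P \<noteq> {}" by auto
    then obtain u v where P: "P = slab i u v" "{u<..<v} \<inter> L = {}"
      using mem by (auto simp: slab_complex_def)
    have "u < v" using False interior_slab by (fastforce simp: P(1))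
    then obtain \<alpha> \<gamma> where "\<forall>x. u < x $ i \<and> x $ i < v \<longrightarrow> \<theta> x = \<alpha> * x $ i + \<gamma>"
      using aff P(2) by blast
    then have "\<forall>x\<in>interior P. \<theta> x = (\<alpha> *\<^sub>R axis i 1) \<bullet> x + \<gamma>"
      using interior_slab by (fastforce simp: P(1) inner_axis')
    then show ?thesis by blast
  qed simp
  then have "piecewise_linear \<theta>"
    unfolding piecewise_linear_def using regular_slab_complex[OF L] by blast
  moreover have "(\<lambda>\<alpha>. \<alpha> *\<^sub>R axis i 1) ` S \<subseteq> slopes \<theta>"
  proof (intro image_subsetI)
    fix \<alpha> assume "\<alpha> \<in> S"
    then obtain u v \<gamma> where "u < v" "\<forall>x. u < x $ i \<and> x $ i < v \<longrightarrow> \<theta> x = \<alpha> * x $ i + \<gamma>"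
      using S(3) by blast
    then show "\<alpha> *\<^sub>R axis i 1 \<in> slopes \<theta>" by (intro slope_on_slab[of u v i]) auto
  qed
  moreover have "inj (\<lambda>\<alpha>. \<alpha> *\<^sub>R (axis i 1 :: real ^ 'n))" by (auto simp: inj_def vec_eq_iff axis_def)
  ultimately show ?thesis
    unfolding has_at_least_slopes_def using S(1,2) by (metis card_image finite_imageI inj_on_subset subset_UNIV)
qed

section \<open>Affine pieces of functions on the line\<close>

definition affine_off :: "real set \<Rightarrow> (real \<Rightarrow> real) \<Rightarrow> bool" where
  "affine_off T g \<longleftrightarrow>
     (\<forall>u v. u < v \<longrightarrow> {u<..<v} \<inter> T = {} \<longrightarrow> (\<exists>\<alpha> \<gamma>. \<forall>t\<in>{u<..<v}. g t = \<alpha> * t + \<gamma>))"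

lemma affine_offE:
  assumes "affine_off T g" "u < v" "{u<..<v} \<inter> T = {}"
  obtains \<alpha> \<gamma> where "\<And>t. u < t \<Longrightarrow> t < v \<Longrightarrow> g t = \<alpha> * t + \<gamma>"
  using assms unfolding affine_off_def by (metis greaterThanLessThan_iff)

lemma affine_off_diff:
  assumes "affine_off S f" "affine_off T g"
  shows "affine_off (S \<union> T) (\<lambda>t. f t - g t)"
  unfolding affine_off_def
proof (intro allI impI)
  fix u v :: real assume uv: "u < v" "{u<..<v} \<inter> (S \<union> T) = {}"
  obtain \<alpha> \<gamma> where f: "\<And>t. u < t \<Longrightarrow> t < v \<Longrightarrow> f t = \<alpha> * t + \<gamma>"
    using affine_offE[OF assms(1) uv(1)] uv(2) by (metis Int_Un_distrib Un_empty)
  obtain \<alpha>' \<gamma>' where g: "\<And>t. u < t \<Longrightarrow> t < v \<Longrightarrow> g t = \<alpha>' * t + \<gamma>'"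
    using affine_offE[OF assms(2) uv(1)] uv(2) by (metis Int_Un_distrib Un_empty)
  show "\<exists>\<alpha> \<gamma>. \<forall>t\<in>{u<..<v}. f t - g t = \<alpha> * t + \<gamma>"
    by (intro exI[of _ "\<alpha> - \<alpha>'"] exI[of _ "\<gamma> - \<gamma>'"]) (simp add: f g algebra_simps)
qed

lemma affine_off_reflect:
  assumes "affine_off T g"
  shows "affine_off ((\<lambda>s. b - s) ` T) (\<lambda>t. g (b - t))"
  unfolding affine_off_def
proof (intro allI impI)
  fix u v :: real assume uv: "u < v" "{u<..<v} \<inter> (\<lambda>s. b - s) ` T = {}"
  have "{b - v<..<b - u} \<inter> T = {}"
  proof (rule ccontr)
    assume "{b - v<..<b - u} \<inter> T \<noteq> {}"
    then obtain s where "s \<in> T" "u < b - s" "b - s < v" by force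
    then have "b - s \<in> {u<..<v} \<inter> (\<lambda>s. b - s) ` T" by simp
    then show False using uv(2) by blast
  qed
  then obtain \<alpha> \<gamma> where g: "\<And>t. b - v < t \<Longrightarrow> t < b - u \<Longrightarrow> g t = \<alpha> * t + \<gamma>"
    using affine_offE[OF assms, of "b - v" "b - u"] uv(1) by (metis diff_strict_left_mono)
  show "\<exists>\<alpha> \<gamma>. \<forall>t\<in>{u<..<v}. g (b - t) = \<alpha> * t + \<gamma>"
    by (intro exI[of _ "- \<alpha>"] exI[of _ "\<alpha> * b + \<gamma>"]) (simp add: g algebra_simps)
qed

lemma affine_off_sawtooth:
  "affine_off (insert 0 ((\<lambda>j. w / 8 ^ j) ` {..<k})) (sawtooth w k)"
proof (induction k)
  case 0
  show ?case unfolding affine_off_def by (intro allI impI exI[of _ 0]) simp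
next
  case (Suc k)
  show ?case unfolding affine_off_def
  proof (intro allI impI)
    fix u v :: real
    assume uv: "u < v" "{u<..<v} \<inter> insert 0 ((\<lambda>j. w / 8 ^ j) ` {..<Suc k}) = {}"
    have "\<not> (u < 0 \<and> 0 < v)" "\<not> (u < w / 8 ^ k \<and> w / 8 ^ k < v)"
      using uv(2) by (auto simp: disjoint_iff)
    \<comment> \<open>An interval without breakpoints lies under the new tooth or misses it.\<close>
    then consider "0 \<le> u" "v \<le> w / 8 ^ k" | "v \<le> 0 \<or> w / 8 ^ k \<le> u" by linarith
    then show "\<exists>\<alpha> \<gamma>. \<forall>t\<in>{u<..<v}. sawtooth w (Suc k) t = \<alpha> * t + \<gamma>"
    proof cases
      case 1
      then show ?thesis by (intro exI[of _ "8 ^ k / (3 * w)"] exI[of _ 0]) auto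
    next
      case 2
      have "{u<..<v} \<inter> insert 0 ((\<lambda>j. w / 8 ^ j) ` {..<k}) = {}"
        using uv(2) by (auto simp: disjoint_iff)
      then obtain \<alpha> \<gamma> where "\<And>t. u < t \<Longrightarrow> t < v \<Longrightarrow> sawtooth w k t = \<alpha> * t + \<gamma>"
        using affine_offE[OF Suc uv(1)] by metis
      then show ?thesis using 2 by (intro exI[of _ \<alpha>] exI[of _ \<gamma>]) auto
    qed
  qed
qed

section \<open>Breakpoints of \<open>F\<close>, and the slopes of the layered function\<close>

context profile
begin

lemma affine_off_base: "\<exists>T. finite T \<and> 0 \<in> T \<and> b \<in> T \<and> affine_off T base"
proof -
  let ?D = "{b, b + 6 * w, 1 - 6 * w}"
  let ?T = "insert 0 ((\<lambda>j. w / 8 ^ j) ` {..<k})"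
  \<comment> \<open>The sign makes \<open>base\<close> an iterated difference: a sawtooth minus this
    function minus the reflected sawtooth.\<close>
  have "affine_off ?D (\<lambda>t. step t - t)"
    unfolding affine_off_def
  proof (intro allI impI)
    fix u v :: real assume "u < v" "{u<..<v} \<inter> ?D = {}"
    then have "\<not> (u < b \<and> b < v)" "\<not> (u < b + 6 * w \<and> b + 6 * w < v)" "\<not> (u < 1 - 6 * w \<and> 1 - 6 * w < v)"
      by (auto simp: disjoint_iff)
    then consider "v \<le> b" | "b \<le> u" "v \<le> b + 6 * w" | "b + 6 * w \<le> u" "v \<le> 1 - 6 * w" | "1 - 6 * w \<le> u"
      by linarith
    then have "\<exists>\<gamma>. \<forall>t\<in>{u<..<v}. step t = \<gamma>"
    proof cases
      case 1
      then show ?thesis by (intro exI[of _ 0]) (auto simp: step_def)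
    next
      case 2
      then show ?thesis by (intro exI[of _ "1 / 3"]) (auto simp: step_def)
    next
      case 3
      then show ?thesis using w_pos by (intro exI[of _ "1 / 2"]) (auto simp: step_def)
    next
      case 4
      then show ?thesis using w_pos w_eq by (intro exI[of _ "2 / 3"]) (auto simp: step_def)
    qed
    then obtain \<gamma> where "\<And>t. t \<in> {u<..<v} \<Longrightarrow> step t = \<gamma>" by blast
    then show "\<exists>\<alpha> \<gamma>. \<forall>t\<in>{u<..<v}. step t - t = \<alpha> * t + \<gamma>"
      by (intro exI[of _ "- 1"] exI[of _ \<gamma>]) simp
  qed
  from affine_off_diff[OF affine_off_diff[OF affine_off_sawtooth[of w k] this]
      affine_off_reflect[OF affine_off_sawtooth[of w k], of b]]
  have "affine_off ((?T \<union> ?D) \<union> (\<lambda>s. b - s) ` ?T) base"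
    by (simp add: base_def[abs_def] algebra_simps)
  then show ?thesis by (intro exI[of _ "(?T \<union> ?D) \<union> (\<lambda>s. b - s) ` ?T"]) simp
qed

lemma F_breakpoints:
  "\<exists>L. \<int> \<subseteq> L \<and> {t. t - b \<in> \<int>} \<subseteq> L \<and> (\<forall>a c. finite (L \<inter> {a..c})) \<and> affine_off L F"
proof -
  obtain T where T: "finite T" "0 \<in> T" "b \<in> T" "affine_off T base"
    using affine_off_base by blast
  \<comment> \<open>As \<open>0\<close> and \<open>b\<close> are in \<open>T\<close>, this contains
    the integers and their translates by \<open>b\<close>, so off \<open>L\<close> the function
    \<open>G\<close> is given by \<open>F\<close>.\<close>
  define L where "L = {t. frac t \<in> T}"
  have Ints: "\<int> \<subseteq> L" using T(2) by (auto simp: L_def frac_eq_0_iff[THEN iffD2])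
  have "frac t = b" if t: "t - b \<in> \<int>" for t
  proof -
    obtain m where "t - b = of_int m" using t by (rule Ints_cases)
    then have "t = b + of_int m" by simp
    then show ?thesis using half_le less_one by (simp add: frac_unique_iff)
  qed
  then have "{t. t - b \<in> \<int>} \<subseteq> L" using T(3) by (auto simp: L_def)
  moreover have "finite (L \<inter> {a..c})" for a c
  proof -
    have "L \<inter> {a..c} \<subseteq> (\<lambda>(m, s). of_int m + s) ` ({\<lfloor>a\<rfloor>..\<lfloor>c\<rfloor>} \<times> T)"
    proof
      fix t assume "t \<in> L \<inter> {a..c}"
      then have "(\<lfloor>t\<rfloor>, frac t) \<in> {\<lfloor>a\<rfloor>..\<lfloor>c\<rfloor>} \<times> T" by (auto simp: L_def floor_mono)
      moreover have "t = (\<lambda>(m, s). of_int m + s) (\<lfloor>t\<rfloor>, frac t)" by (simp add: frac_def)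
      ultimately show "t \<in> (\<lambda>(m, s). of_int m + s) ` ({\<lfloor>a\<rfloor>..\<lfloor>c\<rfloor>} \<times> T)" by (rule rev_image_eqI)
    qed
    then show ?thesis using T(1) by (meson finite_SigmaI finite_atLeastAtMost_int finite_imageI finite_subset)
  qed
  moreover have "affine_off L F"
    unfolding affine_off_def
  proof (intro allI impI)
    fix u v :: real assume uv: "u < v" "{u<..<v} \<inter> L = {}"
    define n where "n = real_of_int \<lfloor>u\<rfloor>"
    have "n + 1 \<in> L" using Ints by (auto simp: n_def)
    moreover have "u < n + 1" unfolding n_def by linarith
    ultimately have v: "v \<le> n + 1"
      using uv(2) unfolding disjoint_iff greaterThanLessThan_iff by (meson not_le)
    have frac: "frac t = t - n" if "u < t" "t < v" for t
    proof -
      have "\<lfloor>t\<rfloor> = \<lfloor>u\<rfloor>" using that v unfolding n_def by linarith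
      then show ?thesis by (simp add: frac_def n_def)
    qed
    have "{u - n<..<v - n} \<inter> T = {}"
    proof (rule ccontr)
      assume "{u - n<..<v - n} \<inter> T \<noteq> {}"
      then obtain s where "s \<in> T" "u < s + n" "s + n < v" by force
      then have "s + n \<in> {u<..<v} \<inter> L" using frac[of "s + n"] by (simp add: L_def)
      then show False using uv(2) by blast
    qed
    then obtain \<alpha> \<gamma> where "\<And>t. u - n < t \<Longrightarrow> t < v - n \<Longrightarrow> base t = \<alpha> * t + \<gamma>"
      using affine_offE[OF T(4), of "u - n" "v - n"] uv(1) by (metis diff_strict_right_mono)
    then show "\<exists>\<alpha> \<gamma>. \<forall>t\<in>{u<..<v}. F t = \<alpha> * t + \<gamma>"
      by (intro exI[of _ \<alpha>] exI[of _ "\<gamma> - \<alpha> * n"]) (simp add: F_def frac algebra_simps)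
  qed
  ultimately show ?thesis using Ints by blast
qed

end

context layer
begin

lemma ridge_function_G: "ridge_function i k (\<lambda>x. G x / b)"
proof -
  obtain L where L: "\<int> \<subseteq> L" "{t. t - b \<in> \<int>} \<subseteq> L" "\<And>a c. finite (L \<inter> {a..c})" "affine_off L F"
    using F_breakpoints by blast
  have gaps: "\<exists>\<alpha> \<gamma>. \<forall>x. u < x $ i \<and> x $ i < v \<longrightarrow> G x / b = \<alpha> * x $ i + \<gamma>"
    if uv: "u < v" "{u<..<v} \<inter> L = {}" for u v
  proof -
    obtain \<alpha> \<gamma> where F: "\<And>t. u < t \<Longrightarrow> t < v \<Longrightarrow> F t = \<alpha> * t + \<gamma>"
      using affine_offE[OF L(4) uv] by metis
    have "G x / b = \<alpha> / b * x $ i + \<gamma> / b" if "u < x $ i" "x $ i < v" for x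
    proof -
      have "x $ i \<notin> L" using that uv(2) by (auto simp: disjoint_iff)
      then have "G x = F (x $ i)" using L(1,2) by (intro G_F) auto
      then show ?thesis using F[OF that] by (simp add: add_divide_distrib)
    qed
    then show ?thesis by blast
  qed
  \<comment> \<open>On tooth \<open>j\<close> the profile is \<open>t + t * 8 ^ j / (3 * w)\<close>;
    dividing by \<open>b\<close> gives this slope, distinct for distinct \<open>j\<close>.\<close>
  define s where "s j = (1 + 8 ^ j / (3 * w)) / b" for j :: nat
  have teeth: "\<exists>u v \<gamma>. u < v \<and> (\<forall>x. u < x $ i \<and> x $ i < v \<longrightarrow> G x / b = s j * x $ i + \<gamma>)" if j: "j < k" for j
  proof (rule exI[of _ "w / 8 ^ Suc j"], rule exI[of _ "w / 8 ^ j"], rule exI[of _ 0], intro conjI allI impI)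
    show "w / 8 ^ Suc j < w / 8 ^ j" using w_pos by (simp add: field_simps)
    fix x assume x: "w / 8 ^ Suc j < x $ i \<and> x $ i < w / 8 ^ j"
    have "0 < w / 8 ^ Suc j" "w / 8 ^ j \<le> w" using w_pos by (auto simp: field_simps)
    then have x0: "0 < x $ i" "x $ i \<le> w" using x by linarith+
    have "x $ i < 1" "x $ i < b" using x0 w_eq w_le by linarith+
    then have "G x = F (x $ i)"
      using x0 half_le less_one Ints_nonzero_abs_less1[of "x $ i"] Ints_nonzero_abs_less1[of "x $ i - b"]
      by (intro G_F) auto
    then show "G x / b = s j * x $ i + 0"
      using F_small[OF x0] sawtooth_tooth[OF w_pos j, of "x $ i"] x
      by (simp add: s_def algebra_simps)
  qed
  have "inj_on s {..<k}"
    using half_le w_pos by (auto simp: inj_on_def s_def)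
  then have card: "card (s ` {..<k}) = k" by (simp add: card_image)
  show ?thesis unfolding ridge_function_def
  proof (rule conjI, goal_cases)
    case 1
    show ?case using L(1,3) gaps by blast
  next
    case 2
    show ?case using card teeth by (intro exI[of _ "s ` {..<k}"]) auto
  qed
qed

end

section \<open>The facet\<close>

text \<open>Each induction step uses the function of the coordinates in \<open>S\<close> as
  \<open>\<rho>\<close> of a new layer. Dependence on \<open>S\<close> alone makes it independent of
  the new coordinate; the statement about zeros is carried along for full-dimensionality.\<close>

lemma (in profile) gauge_function_exists:
  assumes "finite S"
  shows "\<exists>\<rho> :: real ^ 'n \<Rightarrow> real. gauge_function \<rho> \<and> determined (vec b) \<rho> \<and>
    (\<forall>x y. (\<forall>j\<in>S. x $ j = y $ j) \<longrightarrow> \<rho> x = \<rho> y) \<and> (\<forall>x. \<rho> x = 0 \<longrightarrow> (\<forall>j\<in>S. x $ j \<in> \<int>))"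
  using assms
proof induction
  case empty
  have "determined (vec b) (\<lambda>x :: real ^ 'n. 0)"
    unfolding determined_def
  proof (intro allI impI ext)
    fix \<rho>' :: "real ^ 'n \<Rightarrow> real" and x
    assume nonneg: "\<forall>x. 0 \<le> \<rho>' x" and "\<forall>x y. 0 + 0 = (0::real) \<longrightarrow> \<rho>' x + \<rho>' y = \<rho>' (x + y)"
    then have add: "\<rho>' x + \<rho>' y = \<rho>' (x + y)" for x y by simp
    show "\<rho>' x = 0"
      using add[of 0 0] add[of x "- x"] nonneg[rule_format, of x] nonneg[rule_format, of "- x"] by simp
  qed
  then show ?case by (intro exI[of _ "\<lambda>x. 0"]) (simp add: gauge_function_def)
next
  case (insert i S)
  then obtain \<rho> :: "real ^ 'n \<Rightarrow> real" where \<rho>: "gauge_function \<rho>" "determined (vec b) \<rho>"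
    and agree: "\<And>x y. (\<And>j. j \<in> S \<Longrightarrow> x $ j = y $ j) \<Longrightarrow> \<rho> x = \<rho> y"
    and zero: "\<And>x j. \<rho> x = 0 \<Longrightarrow> j \<in> S \<Longrightarrow> x $ j \<in> \<int>"
    by blast
  interpret layer b k i \<rho>
  proof
    show "\<rho> x = \<rho> y" if "\<And>j. j \<noteq> i \<Longrightarrow> x $ j = y $ j" for x y
      using that insert.hyps(2) by (intro agree) metis
  qed (fact \<rho>(1))
  have "G x = G y" if "\<forall>j\<in>insert i S. x $ j = y $ j" for x y
  proof -
    have "\<rho> x = \<rho> y" "\<rho> (\<beta> - x) = \<rho> (\<beta> - y)" by (rule agree; use that in simp)+
    then show ?thesis using that by (simp add: G_def)
  qed
  then show ?case
    using G_gauge determined_G[OF \<rho>(2)] G_zero zero half_le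
    by (intro exI[of _ "\<lambda>x. G x / b"]) auto
qed

text \<open>Coordinate \<open>i\<close> is added last because the affine pieces of the result are
  those of the outermost layer.\<close>

lemma (in profile) ridge_gauge_exists:
  fixes i :: "'n::finite"
  shows "\<exists>\<pi> :: real ^ 'n \<Rightarrow> real. gauge_function \<pi> \<and> determined (vec b) \<pi> \<and>
    (\<forall>x. \<pi> x + \<pi> (vec b - x) = 1) \<and> (\<forall>x. \<pi> x = 0 \<longrightarrow> x \<in> integer_lattice) \<and> ridge_function i k \<pi>"
proof -
  obtain \<rho> :: "real ^ 'n \<Rightarrow> real" where \<rho>: "gauge_function \<rho>" "determined (vec b) \<rho>"
    and indep: "\<forall>x y. (\<forall>j\<in>UNIV - {i}. x $ j = y $ j) \<longrightarrow> \<rho> x = \<rho> y"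
    and zero: "\<forall>x. \<rho> x = 0 \<longrightarrow> (\<forall>j\<in>UNIV - {i}. x $ j \<in> \<int>)"
    using gauge_function_exists[OF finite, of "UNIV - {i}"] by blast
  interpret layer b k i \<rho>
  proof
    show "\<rho> x = \<rho> y" if "\<And>j. j \<noteq> i \<Longrightarrow> x $ j = y $ j" for x y
      using that indep by auto
  qed (fact \<rho>(1))
  have "x \<in> integer_lattice" if "G x = 0" for x
    using G_zero[OF that] zero by (auto simp: integer_lattice_def)
  moreover have "G x / b + G (vec b - x) / b = 1" for x
    using G_sym[of x] half_le by (simp add: add_divide_distrib[symmetric])
  ultimately show ?thesis
    using G_gauge determined_G[OF \<rho>(2)] ridge_function_G half_le
    by (intro exI[of _ "\<lambda>x. G x / b"]) auto
qed

section \<open>Reflection in the origin and arbitrary \<open>b\<close>\<close>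

lemma gauge_function_uminus: "gauge_function \<pi> \<Longrightarrow> gauge_function (\<lambda>x. \<pi> (- x))"
  by (auto simp: gauge_function_def simp flip: minus_add_distrib)
    (metis add.commute minus_add_distrib)

lemma determined_uminus:
  fixes \<pi> :: "real ^ 'n \<Rightarrow> real"
  assumes "determined \<beta> \<pi>"
  shows "determined (- \<beta>) (\<lambda>x. \<pi> (- x))"
  unfolding determined_def
proof (intro allI impI)
  fix \<rho>' :: "real ^ 'n \<Rightarrow> real"
  assume *: "\<forall>x. 0 \<le> \<rho>' x" "\<forall>x y. \<pi> (- x) + \<pi> (- y) = \<pi> (- (x + y)) \<longrightarrow> \<rho>' x + \<rho>' y = \<rho>' (x + y)"
    "\<pi> (- (- \<beta>)) = 1 \<longrightarrow> \<rho>' (- \<beta>) = 1"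
  have "(\<lambda>x. \<rho>' (- x)) = \<pi>"
  proof (rule assms[unfolded determined_def, rule_format])
    show "\<rho>' (- x) + \<rho>' (- y) = \<rho>' (- (x + y))" if "\<pi> x + \<pi> y = \<pi> (x + y)" for x y
      using *(2)[rule_format, of "- x" "- y"] that by (simp add: algebra_simps)
  qed (use * in auto)
  then show "\<rho>' = (\<lambda>x. \<pi> (- x))" by (metis minus_minus)
qed

theorem theorem6p1:
  fixes k :: nat and b :: real
  assumes "k \<ge> 1" and "b \<notin> \<int>"
  shows "\<exists>\<pi> :: real ^ 'n \<Rightarrow> real.
           (\<forall>x. 0 \<le> \<pi> x) \<and>
           has_at_least_slopes k \<pi> \<and>
           genuinely_full_dimensional \<pi> \<and>
           facet_function (vec b) \<pi> \<and>
           extreme_function (vec b) \<pi>"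
proof -
  obtain i :: 'n where True by blast
  have "\<exists>\<beta> \<pi>. gauge_function \<pi> \<and> determined \<beta> \<pi> \<and> (\<forall>x. \<pi> x + \<pi> (\<beta> - x) = 1) \<and>
    (\<forall>x :: real ^ 'n. \<pi> x = 0 \<longrightarrow> x \<in> integer_lattice) \<and> ridge_function i k \<pi> \<and>
    \<beta> - vec b \<in> integer_lattice"
  proof (cases "1 / 2 \<le> frac b")
    case True
    interpret profile "frac b" k
      using True assms frac_lt_1 by unfold_locales auto
    have "vec (frac b) - vec b \<in> (integer_lattice :: (real ^ 'n) set)"
      by (simp add: integer_lattice_def frac_def)
    then show ?thesis using ridge_gauge_exists[of i] by blast
  next
    case False
    \<comment> \<open>Since \<open>b\<close> is no integer, \<open>frac (- b) = 1 - frac b\<close>,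
      which exceeds \<open>1 / 2\<close>. The reflected function belongs to
      \<open>- vec (frac (- b))\<close>, which is \<open>vec b\<close> modulo the lattice.\<close>
    interpret profile "frac (- b)" k
      using False assms frac_lt_1[of "- b"] by unfold_locales (auto simp: frac_neg)
    obtain \<pi> :: "real ^ 'n \<Rightarrow> real" where \<pi>: "gauge_function \<pi>" "determined (vec (frac (- b))) \<pi>"
      "\<And>x. \<pi> x + \<pi> (vec (frac (- b)) - x) = 1" "\<And>x. \<pi> x = 0 \<Longrightarrow> x \<in> integer_lattice"
      "ridge_function i k \<pi>"
      using ridge_gauge_exists[of i] by blast
    have "- vec (frac (- b)) - vec b \<in> (integer_lattice :: (real ^ 'n) set)"
      by (simp add: integer_lattice_def frac_def)
    moreover have "x \<in> integer_lattice" if "\<pi> (- x) = 0" for x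
      using integer_lattice_simps(3)[OF \<pi>(4)[OF that]] by simp
    moreover have "\<pi> (- x) + \<pi> (- (- vec (frac (- b)) - x)) = 1" for x
      using \<pi>(3)[of "- x"] by (simp add: algebra_simps)
    ultimately show ?thesis
      using gauge_function_uminus[OF \<pi>(1)] determined_uminus[OF \<pi>(2)] ridge_function_uminus[OF \<pi>(5)]
      by (intro exI[of _ "- vec (frac (- b))"] exI[of _ "\<lambda>x. \<pi> (- x)"]) auto
  qed
  then obtain \<beta> and \<pi> :: "real ^ 'n \<Rightarrow> real" where \<pi>: "gauge_function \<pi>" "determined \<beta> \<pi>"
    "\<And>x. \<pi> x + \<pi> (\<beta> - x) = 1" "\<And>x. \<pi> x = 0 \<Longrightarrow> x \<in> integer_lattice"
    "ridge_function i k \<pi>" "\<beta> - vec b \<in> integer_lattice"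
    by blast
  have nonneg: "0 \<le> \<pi> x" and zero: "\<pi> 0 = 0" for x using \<pi>(1) by (auto simp: gauge_function_def)
  have "facet_function (vec b) \<pi>"
    using facet_function_if_determined[OF \<pi>(1-3) _ \<pi>(6)] by simp
  then show ?thesis
    using nonneg ridge_function_slopes[OF \<pi>(5)] genuinely_full_dimensional_if_zeros[of \<pi>, OF zero \<pi>(4)]
      extreme_function_if_facet by blast
qed

end
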